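(* Let $h\in L^0(M,N)$ and $p\in(1,\infty)$. Suppose that $N$ is complete. Then the isometric mapping $\tilde i_p:\mathcal{AC}^p(I,L^p_h(M,N))\to L^p_{\underline h}(M,\mathcal{AC}^p(I,N))$ satisfies $$\tilde i_p(\mathcal{G}(I,L^p_h(M,N)))\subset L^p_{\underline h}(M,\mathcal{G}(I,N)).$$
   Context: Setting: $(M,\Sigma_M,\mu_M)$ is a measure space with $M$ nonempty (no $\sigma$-finiteness assumed), $(N,d_N)$ is a nonempty metric space with finite metric, and $I=[a,b]\subset\mathbb{R}$ with $a<b$, equipped with Lebesgue measure $\mathscr{L}^1$. For a measure space $(Y,\Sigma_Y,\mu_Y)$ and a nonempty metric space $(Z,d_Z)$: $L^0(Y,Z)$ is the set of $\mu_Y$-a.e.-equality classes $[f]_Y$ of measurable maps $f:Y\to Z$ (Borel $\sigma$-algebra on $Z$) with separable range. For $g\in L^0(Y,Z)$ and $p\in[1,\infty)$, $L^p_g(Y,Z)$ is the set of $f\in L^0(Y,Z)$ with $\int_Y d_Z(f,g)^p\,d\mu_Y<\infty$, with the metric $(f,f')\mapsto(\int_Y d_Z(f,f')^p\,d\mu_Y)^{1/p}$. $L^p(I,Z)$ denotes $L^p_g(I,Z)$ with $g$ constant (all constants give the same space when $d_Z$ is finite). Classes and representatives are not distinguished when clear from context. $I\times M$ carries the product measure $\mathscr{L}^1\otimes\mu_M$ obtained by Carathéodory's process from measurable rectangles. Given $h\in L^0(M,N)$: $\hat h(t,x)=h(x)$ on $I\times M$; $\underline h(x)$ is the constant curve $t\mapsto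 h(x)$ in $N$. Metrics: $D_p$ on $L^p_h(M,N)$; $d_p(c,c')=(\int_I d_N(c(t),c'(t))^pdt)^{1/p}$ on curves in $N$; $d_{p,p}(c,c')=(\int_I D_p(c(t),c'(t))^p dt)^{1/p}$; $D_{p,p}(f,f')=(\int_M d_p(f(x),f'(x))^p d\mu_M(x))^{1/p}$. When $N$ is complete, $\bar i_p:=\overline{\operatorname{sec}}_{M,p}\circ\overline{\operatorname{sec}}_{I,p}^{-1}:L^p(I,L^p_h(M,N))\to L^p_{\underline h}(M,L^p(I,N))$ is a surjective isometry, where $\overline{\operatorname{sec}}_{I,p}:L^p_{\hat h}(I\times M,N)\to L^p(I,L^p_h(M,N))$, $[\hat c]_{I\times M}\mapsto[t\mapsto[\hat c(t,\cdot)]_M]_I$, and $\overline{\operatorname{sec}}_{M,p}:L^p_{\hat h}(I\times M,N)\to L^p_{\underline h}(M,L^p(I,N))$, $[\hat c]_{I\times M}\mapsto[x\mapsto[\hat c(\cdot,x)]_I]_M$, are surjective isometries. For a metric space $(X,d_X)$, $\mathcal{AC}^p(I,X)$ is the set of curves $c:I\to X$ for which there is $m\in L^p(I)$ with $d_X(c(s),c(t))\le\int_s^t m(r)\,dr$ for all $s\le t$ in $I$. $\mathcal{G}(I,X)\subset\mathcal{AC}^p(I,X)$ is the set of constant speed geodesics: curves $c:I\to X$ with $d_X(c(a),c(b))<\infty$ and $d_X(c(s),c(t))=\left|\frac{t-s}{b-a}\right|d_X(c(a),c(b))$ for all $s,t\in I$. For $\mathcal{A}=\mathcal{AC}^p(I,N)$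 or $\mathcal{A}=\mathcal{G}(I,N)$, $L^p_{\underline h}(M,\mathcal{A})$ is the set of a.e.-equality classes of measurable, separably valued maps $f:M\to(\mathcal{A},d_p)$ with $D_{p,p}(f,\underline h)<\infty$. The mapping $\tilde i_p:=(q_p^{-1})_*\circ\bar i_p\circ Q_p:(\mathcal{AC}^p(I,L^p_h(M,N)),d_{p,p})\to(L^p_{\underline h}(M,\mathcal{AC}^p(I,N)),D_{p,p})$ is well-defined and distance-preserving; here $q_p:\mathcal{AC}^p(I,N)\to L^p(I,N)$ and $Q_p:\mathcal{AC}^p(I,L^p_h(M,N))\to L^p(I,L^p_h(M,N))$ are the injective maps $c\mapsto[c]_I$, and $(q_p^{-1})_*$ is post-composition with $q_p^{-1}$ (defined on the range of $q_p$). It satisfies $c(t)=[x\mapsto\tilde i_p(c)(x)(t)]_M$ for all $c\in\mathcal{AC}^p(I,L^p_h(M,N))$ and $t\in I$. *)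

theory Defs
  imports "HOL-Analysis.Analysis"
begin

text \<open>
  A metric space is given by a carrier \<open>Z\<close> and a distance function \<open>d\<close>, as in the locale
  \<^locale>\<open>Metric_space\<close>.  This allows the spaces of equivalence classes and of curves below
  to be used as target spaces in turn.
\<close>

section \<open>Measurable maps up to equality almost everywhere\<close>

definition borel_metric :: "'z set \<Rightarrow> ('z \<Rightarrow> 'z \<Rightarrow> real) \<Rightarrow> 'z measure" where
  "borel_metric Z d = sigma Z {U. openin (Metric_space.mtopology Z d) U}"

definition separably_measurable ::
    "'y measure \<Rightarrow> 'z set \<Rightarrow> ('z \<Rightarrow> 'z \<Rightarrow> real) \<Rightarrow> ('y \<Rightarrow> 'z) set" where
  "separably_measurable Y Z d =
     {f \<in> Y \<rightarrow>\<^sub>M borel_metric Z d.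
        separable_space (subtopology (Metric_space.mtopology Z d) (f ` space Y))}"

text \<open>
  The class \<open>[f]\<close> is taken in the set of all functions on the underlying type, measurable or not
  and with arbitrary values on a null set and outside \<open>space Y\<close>.  Two measurable maps have the
  same class iff they agree almost everywhere, and the class of a map does not depend on
  the target space: for \<open>Z \<subseteq> Z'\<close> (with the same distance) \<open>L0 Y Z d\<close> consists of those
  members of \<open>L0 Y Z' d\<close> that have a measurable, separably valued representative with
  values in \<open>Z\<close>.
\<close>

definition ae_class :: "'y measure \<Rightarrow> ('y \<Rightarrow> 'z) \<Rightarrow> ('y \<Rightarrow> 'z) set" where
  "ae_class Y f = {g. AE y in Y. g y = f y}"

definition L0 :: "'y measure \<Rightarrow> 'z set \<Rightarrow> ('z \<Rightarrow> 'z \<Rightarrow> real) \<Rightarrow> ('y \<Rightarrow> 'z) set set" where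
  "L0 Y Z d = ae_class Y ` separably_measurable Y Z d"

text \<open>
  An arbitrary representative.  It need not be measurable, but it is almost everywhere equal to
  every measurable representative; in particular \<open>nn_integral\<close> does not see the difference.
\<close>

definition rep :: "('y \<Rightarrow> 'z) set \<Rightarrow> 'y \<Rightarrow> 'z" where
  "rep F = (SOME f. f \<in> F)"

section \<open>Lebesgue spaces with values in a metric space\<close>

definition pow_integral ::
    "real \<Rightarrow> 'y measure \<Rightarrow> ('z \<Rightarrow> 'z \<Rightarrow> real) \<Rightarrow> ('y \<Rightarrow> 'z) \<Rightarrow> ('y \<Rightarrow> 'z) \<Rightarrow> ennreal" where
  "pow_integral p Y d f g = (\<integral>\<^sup>+ y. ennreal (d (f y) (g y) powr p) \<partial>Y)"

definition fun_dist ::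
    "real \<Rightarrow> 'y measure \<Rightarrow> ('z \<Rightarrow> 'z \<Rightarrow> real) \<Rightarrow> ('y \<Rightarrow> 'z) \<Rightarrow> ('y \<Rightarrow> 'z) \<Rightarrow> real" where
  "fun_dist p Y d f g = enn2real (pow_integral p Y d f g) powr (1 / p)"

definition Lp_dist ::
    "real \<Rightarrow> 'y measure \<Rightarrow> ('z \<Rightarrow> 'z \<Rightarrow> real) \<Rightarrow> ('y \<Rightarrow> 'z) set \<Rightarrow> ('y \<Rightarrow> 'z) set \<Rightarrow> real" where
  "Lp_dist p Y d F G = fun_dist p Y d (rep F) (rep G)"

text \<open>The space \<open>L\<^sup>p\<^sub>g(Y, Z)\<close>, where \<open>G\<close> is the class of \<open>g\<close>.\<close>

definition Lp ::
    "real \<Rightarrow> 'y measure \<Rightarrow> 'z set \<Rightarrow> ('z \<Rightarrow> 'z \<Rightarrow> real) \<Rightarrow> ('y \<Rightarrow> 'z) set \<Rightarrow> ('y \<Rightarrow> 'z) set set" where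
  "Lp p Y Z d G = {F \<in> L0 Y Z d. pow_integral p Y d (rep F) (rep G) < \<infinity>}"

abbreviation leb :: "real \<Rightarrow> real \<Rightarrow> real measure" where
  "leb a b \<equiv> lebesgue_on {a..b}"

section \<open>Product measure\<close>

text \<open>
  The measure \<open>A \<Otimes>\<^sub>M B\<close> of the library is only meaningful for \<open>\<sigma>\<close>-finite \<open>B\<close>.  For
  arbitrary measure spaces the product measure is obtained here from the outer measure
  induced by measurable rectangles; its domain consists of all sets that are measurable in the
  sense of Caratheodory.
\<close>

definition rect_outer :: "'x measure \<Rightarrow> 'y measure \<Rightarrow> ('x \<times> 'y) set \<Rightarrow> ennreal" where
  "rect_outer A B E =
     (INF (S, T) \<in> {(S, T). range S \<subseteq> sets A \<and> range T \<subseteq> sets B \<and> E \<subseteq> (\<Union>i::nat. S i \<times> T i)}.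
        \<Sum>i. emeasure A (S i) * emeasure B (T i))"

definition prod_caratheodory :: "'x measure \<Rightarrow> 'y measure \<Rightarrow> ('x \<times> 'y) measure" where
  "prod_caratheodory A B =
     measure_of (space A \<times> space B)
       (lambda_system (space A \<times> space B) (Pow (space A \<times> space B)) (rect_outer A B))
       (rect_outer A B)"

section \<open>Curves\<close>

text \<open>Curves on \<open>[a, b]\<close> are extensional functions, so that they are determined by their
  values on \<open>[a, b]\<close>.\<close>

definition AC ::
    "real \<Rightarrow> real \<Rightarrow> real \<Rightarrow> 'x set \<Rightarrow> ('x \<Rightarrow> 'x \<Rightarrow> real) \<Rightarrow> (real \<Rightarrow> 'x) set" where
  "AC p a b X d =
     {c \<in> {a..b} \<rightarrow>\<^sub>E X.
        \<exists>m :: real \<Rightarrow> real.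
          m \<in> borel_measurable (leb a b) \<and>
          integrable (leb a b) (\<lambda>r. \<bar>m r\<bar> powr p) \<and>
          (\<forall>s\<in>{a..b}. \<forall>t\<in>{a..b}. s \<le> t \<longrightarrow> d (c s) (c t) \<le> (LINT r:{s..t}|lebesgue. m r))}"

definition geodesics ::
    "real \<Rightarrow> real \<Rightarrow> 'x set \<Rightarrow> ('x \<Rightarrow> 'x \<Rightarrow> real) \<Rightarrow> (real \<Rightarrow> 'x) set" where
  "geodesics a b X d =
     {c \<in> {a..b} \<rightarrow>\<^sub>E X.
        \<forall>s\<in>{a..b}. \<forall>t\<in>{a..b}. d (c s) (c t) = \<bar>(t - s) / (b - a)\<bar> * d (c a) (c b)}"

text \<open>
  The map \<open>(q\<^sub>p\<inverse>)\<^sub>*\<close> replaces, for almost every \<open>x\<close>, the class \<open>F(x)\<close> by its unique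
  representative in \<open>AC p a b N d\<close>.
\<close>

definition postcomp_q_inv ::
    "real \<Rightarrow> real \<Rightarrow> real \<Rightarrow> 'm measure \<Rightarrow> 'n set \<Rightarrow> ('n \<Rightarrow> 'n \<Rightarrow> real) \<Rightarrow>
     ('m \<Rightarrow> (real \<Rightarrow> 'n) set) set \<Rightarrow> ('m \<Rightarrow> real \<Rightarrow> 'n) set" where
  "postcomp_q_inv p a b M N d F =
     ae_class M (\<lambda>x. inv_into (AC p a b N d) (ae_class (leb a b)) (rep F x))"

section \<open>The mapping between curves of maps and maps of curves\<close>

definition hat :: "real \<Rightarrow> real \<Rightarrow> 'm measure \<Rightarrow> ('m \<Rightarrow> 'n) set \<Rightarrow> (real \<times> 'm \<Rightarrow> 'n) set" where
  "hat a b M h = ae_class (prod_caratheodory (leb a b) M) (\<lambda>(t, x). rep h x)"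

text \<open>The class of the map \<open>x \<mapsto> (t \<mapsto> h x)\<close>, with values in the space of curves.\<close>

definition const_curves ::
    "real \<Rightarrow> real \<Rightarrow> 'm measure \<Rightarrow> ('m \<Rightarrow> 'n) set \<Rightarrow> ('m \<Rightarrow> real \<Rightarrow> 'n) set" where
  "const_curves a b M h = ae_class M (\<lambda>x. \<lambda>t\<in>{a..b}. rep h x)"

definition sec_I ::
    "real \<Rightarrow> real \<Rightarrow> 'm measure \<Rightarrow> (real \<times> 'm \<Rightarrow> 'n) set \<Rightarrow> (real \<Rightarrow> ('m \<Rightarrow> 'n) set) set" where
  "sec_I a b M C = ae_class (leb a b) (\<lambda>t. ae_class M (\<lambda>x. rep C (t, x)))"

definition sec_M ::
    "real \<Rightarrow> real \<Rightarrow> 'm measure \<Rightarrow> (real \<times> 'm \<Rightarrow> 'n) set \<Rightarrow> ('m \<Rightarrow> (real \<Rightarrow> 'n) set) set" where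
  "sec_M a b M C = ae_class M (\<lambda>x. ae_class (leb a b) (\<lambda>t. rep C (t, x)))"

text \<open>
  On the set of classes used as domain of the inverse, \<open>sec_I\<close> is injective, with image
  \<open>L\<^sup>p(I, L\<^sup>p\<^sub>h(M, N))\<close> if \<open>N\<close> is complete.  By Fubini, the values of \<open>sec_I\<close> and \<open>sec_M\<close>
  do not depend on the representative of the class.
\<close>

definition i_bar ::
    "real \<Rightarrow> real \<Rightarrow> real \<Rightarrow> 'm measure \<Rightarrow> 'n set \<Rightarrow> ('n \<Rightarrow> 'n \<Rightarrow> real) \<Rightarrow> ('m \<Rightarrow> 'n) set \<Rightarrow>
     (real \<Rightarrow> ('m \<Rightarrow> 'n) set) set \<Rightarrow> ('m \<Rightarrow> (real \<Rightarrow> 'n) set) set" where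
  "i_bar p a b M N d h =
     sec_M a b M \<circ>
     inv_into (Lp p (prod_caratheodory (leb a b) M) N d (hat a b M h)) (sec_I a b M)"

definition i_tilde ::
    "real \<Rightarrow> real \<Rightarrow> real \<Rightarrow> 'm measure \<Rightarrow> 'n set \<Rightarrow> ('n \<Rightarrow> 'n \<Rightarrow> real) \<Rightarrow> ('m \<Rightarrow> 'n) set \<Rightarrow>
     (real \<Rightarrow> ('m \<Rightarrow> 'n) set) \<Rightarrow> ('m \<Rightarrow> real \<Rightarrow> 'n) set" where
  "i_tilde p a b M N d h =
     postcomp_q_inv p a b M N d \<circ> i_bar p a b M N d h \<circ> ae_class (leb a b)"

end

theory Submission
  imports Defs
begin

text \<open>
Write \<open>c(t) = [g\<^sub>t]\<close> for a geodesic \<open>c\<close> of \<open>L\<^sup>p\<^sub>h(M, N)\<close>.  For \<open>s < t < u\<close> the distances between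
\<open>c(s)\<close>, \<open>c(t)\<close> and \<open>c(u)\<close> add up, so the chain consisting of the triangle inequality in \<open>N\<close> and
Minkowski's inequality collapses to equalities.  Since \<open>p > 1\<close>, the power function is strictly
convex and equality in Minkowski's inequality forces proportionality: for almost every \<open>x\<close> the
three points \<open>g\<^sub>s x\<close>, \<open>g\<^sub>t x\<close>, \<open>g\<^sub>u x\<close> divide their distances in the ratio of the times
(lemmas \<open>Minkowski_equality_AE\<close> and \<open>Lp_geodesic_pointwise\<close>).  Hence, outside a null set of \<open>x\<close>, the
curve \<open>t \<mapsto> g\<^sub>t x\<close> has constant speed on a countable dense set of times, and by completeness of
\<open>N\<close> it extends to a geodesic \<open>\<gamma>\<^sub>x\<close>.  Any further time can be adjoined to the countable set, so
\<open>\<gamma>\<^sub>x(t) = g\<^sub>t x\<close> for almost every \<open>x\<close>, for each \<open>t\<close> (lemma \<open>geodesic_selection\<close>).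

It remains to see that the isometry sends \<open>c\<close> to the class of \<open>\<gamma>\<close> (lemma \<open>i_tilde_geodesic\<close>).  The
map \<open>\<Gamma>(t, x) = \<gamma>\<^sub>x(t)\<close> is measurable for the product measure and has finite distance to \<open>h\<close>, and its
sections in \<open>x\<close> are the \<open>c(t)\<close>.  No other class has these sections: two maps of finite distance
differ on a countable union of sets of finite measure; if almost all sections of such a set are
null, then the set is null
(lemma \<open>emeasure_prod_caratheodory_eq_0_if_null_sections\<close>).  As \<open>M\<close> may fail to be \<open>\<sigma>\<close>-finite, this is derived from Tonelli's theorem for countable unions of rectangles, which has
an elementary proof.  So the class of \<open>\<Gamma>\<close> is the preimage of \<open>c\<close>; its sections in \<open>t\<close> are the classes
of the \<open>\<gamma>\<^sub>x\<close>, and an absolutely continuous curve is determined by its class.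

Finally \<open>x \<mapsto> \<gamma>\<^sub>x\<close> is measurable with separable range for the distance \<open>d\<^sub>p\<close> on geodesics,
because a geodesic is determined up to a small error by its values on a fine grid and a bound on its length
(lemma \<open>separably_measurable_geodesics\<close>).
\<close>

section \<open>Separably measurable maps into a metric space\<close>

text \<open>
The approximating points may lie anywhere in the space: a point of \<open>A\<close> near \<open>z\<close> can be chosen for
each \<open>z\<close> and each error, and these choices form a countable dense subset of \<open>A\<close>.
\<close>

lemma (in Metric_space) separable_subtopology_iff:
  assumes A: "A \<subseteq> M"
  shows "separable_space (subtopology mtopology A) \<longleftrightarrow>
    (\<exists>D. countable D \<and> D \<subseteq> M \<and> (\<forall>x\<in>A. \<forall>e>0. \<exists>z\<in>D. d z x < e))" (is "?L \<longleftrightarrow> ?R")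
proof -
  have top: "topspace (subtopology mtopology A) = A"
    using A by auto
  have cl: "subtopology mtopology A closure_of C = A \<longleftrightarrow> (\<forall>x\<in>A. \<forall>e>0. \<exists>z\<in>C. d z x < e)"
    if "C \<subseteq> A" for C
  proof -
    have "subtopology mtopology A closure_of C = A \<inter> mtopology closure_of C"
      using that by (simp add: closure_of_subtopology Int_absorb1)
    moreover have "x \<in> mtopology closure_of C \<longleftrightarrow> (\<forall>e>0. \<exists>z\<in>C. d z x < e)" if "x \<in> A" for x
      using that A \<open>C \<subseteq> A\<close> unfolding metric_closure_of
      by (simp add: subset_iff) (metis commute)
    ultimately show ?thesis by blast
  qed
  show ?thesis
  proof
    assume ?L
    then obtain C where "countable C" "C \<subseteq> A" "subtopology mtopology A closure_of C = A"
      unfolding separable_space_def top by metis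
    then show ?R using A cl by (intro exI[of _ C]) auto
  next
    assume ?R
    then obtain D where D: "countable D" "D \<subseteq> M" "\<And>x e. x \<in> A \<Longrightarrow> e > 0 \<Longrightarrow> \<exists>z\<in>D. d z x < e"
      by metis
    define s where "s = (\<lambda>(z, n::nat). SOME x. x \<in> A \<and> d z x < 1 / Suc n)"
    define C where "C = s ` {(z, n). z \<in> D \<and> (\<exists>x. x \<in> A \<and> d z x < 1 / Suc n)}"
    have s: "s (z, n) \<in> A \<and> d z (s (z, n)) < 1 / Suc n" if "\<exists>x. x \<in> A \<and> d z x < 1 / Suc n" for z n
      using someI_ex[OF that] by (simp add: s_def)
    have "countable C"
      unfolding C_def
      by (rule countable_image, rule countable_subset[of _ "D \<times> UNIV"]) (use D in auto)
    moreover have CA: "C \<subseteq> A" unfolding C_def using s by fast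
    moreover have "\<exists>z\<in>C. d z x < e" if "x \<in> A" "e > 0" for x e
    proof -
      obtain n :: nat where n: "1 / Suc n < e / 2"
        using \<open>e > 0\<close> by (metis half_gt_zero nat_approx_posE)
      obtain z where z: "z \<in> D" "d z x < 1 / Suc n"
        using D(3)[OF \<open>x \<in> A\<close>, of "1 / Suc n"] by auto
      then have sz: "s (z, n) \<in> A" "d z (s (z, n)) < 1 / Suc n" using s that by blast+
      have "d (s (z, n)) x \<le> d z (s (z, n)) + d z x"
        using sz z D A that by (intro triangle'') auto
      then have "d (s (z, n)) x < e" using sz z n by linarith
      moreover have "s (z, n) \<in> C" using z that unfolding C_def by blast
      ultimately show ?thesis by blast
    qed
    ultimately show ?L
      unfolding separable_space_def top using cl[OF CA] by blast
  qed
qed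

text \<open>
On a separable set every open set is a countable union of balls, so that measurability reduces
to that of the real functions \<open>y \<mapsto> d z (f y)\<close>, which behave well under limits.
\<close>

lemma (in Metric_space) separably_measurable_iff:
  "f \<in> separably_measurable Y M d \<longleftrightarrow>
     f \<in> space Y \<rightarrow> M \<and> (\<forall>z\<in>M. (\<lambda>y. d z (f y)) \<in> borel_measurable Y) \<and>
     (\<exists>D. countable D \<and> D \<subseteq> M \<and> (\<forall>y\<in>space Y. \<forall>e>0. \<exists>z\<in>D. d z (f y) < e))"
    (is "?L \<longleftrightarrow> ?R")
proof
  have op: "{U. openin mtopology U} \<subseteq> Pow M"
    using openin_subset by fastforce
  assume ?L
  then have f: "f \<in> Y \<rightarrow>\<^sub>M borel_metric M d"
    and sep: "separable_space (subtopology mtopology (f ` space Y))"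
    by (auto simp: separably_measurable_def)
  have "space (borel_metric M d) = M"
    using op by (simp add: borel_metric_def space_measure_of)
  then have fM: "f \<in> space Y \<rightarrow> M"
    using measurable_space[OF f] by auto
  moreover have "(\<lambda>y. d z (f y)) \<in> borel_measurable Y" if "z \<in> M" for z
  proof (rule borel_measurableI_less)
    fix r
    have "mball z r \<in> sets (borel_metric M d)"
      using op by (auto simp: borel_metric_def)
    then have "f -` mball z r \<inter> space Y \<in> sets Y" using f by (rule measurable_sets[rotated])
    also have "f -` mball z r \<inter> space Y = {y \<in> space Y. d z (f y) < r}"
      using fM \<open>z \<in> M\<close> by auto
    finally show "{y \<in> space Y. d z (f y) < r} \<in> sets Y" .
  qed
  moreover have "f ` space Y \<subseteq> M" using fM by auto
  ultimately show ?R using sep separable_subtopology_iff[of "f ` space Y"] by simp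
next
  have op: "{U. openin mtopology U} \<subseteq> Pow M"
    using openin_subset by fastforce
  assume ?R
  then obtain D where fM: "f \<in> space Y \<rightarrow> M"
    and m[measurable]: "\<And>z. z \<in> M \<Longrightarrow> (\<lambda>y. d z (f y)) \<in> borel_measurable Y"
    and D: "countable D" "D \<subseteq> M" "\<And>y e. y \<in> space Y \<Longrightarrow> e > 0 \<Longrightarrow> \<exists>z\<in>D. d z (f y) < e"
    by metis
  have "f \<in> Y \<rightarrow>\<^sub>M borel_metric M d"
    unfolding borel_metric_def
  proof (rule measurable_measure_of[OF op fM])
    fix U assume "U \<in> {U. openin mtopology U}"
    then have U: "U \<subseteq> M" "\<And>x. x \<in> U \<Longrightarrow> \<exists>r>0. mball x r \<subseteq> U"
      by (auto simp: openin_mtopology)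
    define I where "I = {(z, q). z \<in> D \<and> q \<in> \<rat> \<and> mball z q \<subseteq> U}"
    have "countable I"
      by (rule countable_subset[of _ "D \<times> \<rat>"]) (auto simp: I_def D countable_rat)
    have "f -` U \<inter> space Y = (\<Union>(z, q)\<in>I. {y \<in> space Y. d z (f y) < q})" (is "_ = ?S")
    proof
      show "?S \<subseteq> f -` U \<inter> space Y" using D fM by (auto simp: I_def subset_iff)
    next
      show "f -` U \<inter> space Y \<subseteq> ?S"
      proof
        fix y assume y: "y \<in> f -` U \<inter> space Y"
        then obtain r where r: "r > 0" "mball (f y) r \<subseteq> U" using U(2) by auto
        obtain q where q: "q \<in> \<rat>" "0 < q" "q < r / 2"
          using Rats_dense_in_real[of 0 "r / 2"] r by auto
        obtain z where z: "z \<in> D" "d z (f y) < q" using D(3) q y by blast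
        have "mball z q \<subseteq> mball (f y) r"
          using z q D y U(1) by (intro mball_subset) auto
        then have "(z, q) \<in> I" using r z q by (auto simp: I_def)
        then show "y \<in> ?S" using y z by auto
      qed
    qed
    also have "\<dots> \<in> sets Y"
      using \<open>countable I\<close> D by (intro sets.countable_UN') (auto simp: I_def subset_iff)
    finally show "f -` U \<inter> space Y \<in> sets Y" .
  qed
  moreover have "f ` space Y \<subseteq> M" using fM by auto
  then have "separable_space (subtopology mtopology (f ` space Y))"
    using D(1,2) by (subst separable_subtopology_iff) (auto intro!: exI[of _ D] D(3))
  ultimately show ?L by (simp add: separably_measurable_def)
qed

lemma (in Metric_space) separably_measurable_space:
  "f \<in> separably_measurable Y M d \<Longrightarrow> y \<in> space Y \<Longrightarrow> f y \<in> M"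
  using Pi_mem[of f "space Y" "\<lambda>_. M"] separably_measurable_iff[of f Y] by simp

lemma (in Metric_space) separably_measurable_mdist:
  "f \<in> separably_measurable Y M d \<Longrightarrow> z \<in> M \<Longrightarrow> (\<lambda>y. d z (f y)) \<in> borel_measurable Y"
  using separably_measurable_iff[of f Y] by simp

lemma (in Metric_space) separably_measurable_approx:
  assumes "f \<in> separably_measurable Y M d"
  obtains D where "countable D" "D \<subseteq> M" "\<forall>y\<in>space Y. \<forall>e>0. \<exists>z\<in>D. d z (f y) < e"
  using assms(1) separably_measurable_iff[of f Y] by metis

lemma (in Metric_space) separably_measurableI:
  assumes "\<And>y. y \<in> space Y \<Longrightarrow> f y \<in> M"
    and "\<And>z. z \<in> M \<Longrightarrow> (\<lambda>y. d z (f y)) \<in> borel_measurable Y"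
    and "countable D" "D \<subseteq> M" "\<And>y e. y \<in> space Y \<Longrightarrow> e > 0 \<Longrightarrow> \<exists>z\<in>D. d z (f y) < e"
  shows "f \<in> separably_measurable Y M d"
  unfolding separably_measurable_iff
  using assms by (intro conjI exI[of _ D] ballI Pi_I allI impI)

lemma (in Metric_space) separably_measurable_const:
  "z \<in> M \<Longrightarrow> (\<lambda>_. z) \<in> separably_measurable Y M d"
  by (rule separably_measurableI[where D="{z}"]) auto

lemma (in Metric_space) separably_measurable_compose:
  assumes f: "f \<in> separably_measurable Y M d" and v: "v \<in> Z \<rightarrow>\<^sub>M Y"
  shows "(\<lambda>z. f (v z)) \<in> separably_measurable Z M d"
proof -
  obtain D where D: "countable D" "D \<subseteq> M" "\<forall>y\<in>space Y. \<forall>e>0. \<exists>w\<in>D. d w (f y) < e"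
    by (rule separably_measurable_approx[OF f])
  show ?thesis
  proof (rule separably_measurableI[OF _ _ D(1,2)])
    show "f (v z) \<in> M" if "z \<in> space Z" for z
      by (rule separably_measurable_space[OF f measurable_space[OF v that]])
    show "(\<lambda>z. d w (f (v z))) \<in> borel_measurable Z" if "w \<in> M" for w
      by (rule measurable_compose[OF v separably_measurable_mdist[OF f that]])
    show "\<exists>w\<in>D. d w (f (v z)) < e" if "z \<in> space Z" "e > 0" for z e
      using D(3) measurable_space[OF v that(1)] that(2) by blast
  qed
qed

text \<open>
The Borel \<open>\<sigma>\<close>-algebra of a product of metric spaces may exceed the product of the Borel
\<open>\<sigma>\<close>-algebras; separability of the range of \<open>f\<close> replaces the distance by an infimum of
\<open>d z (f y) + d z (g y)\<close> over countably many \<open>z\<close>.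
\<close>

lemma (in Metric_space) borel_measurable_mdist:
  assumes "f \<in> separably_measurable Y M d" "g \<in> separably_measurable Y M d"
  shows "(\<lambda>y. d (f y) (g y)) \<in> borel_measurable Y"
proof (rule borel_measurableI_less)
  fix r
  obtain D where D: "countable D" "D \<subseteq> M" "\<forall>y\<in>space Y. \<forall>e>0. \<exists>z\<in>D. d z (f y) < e"
    by (rule separably_measurable_approx[OF assms(1)])
  note m[measurable] = separably_measurable_mdist[OF assms(1)] separably_measurable_mdist[OF assms(2)]
  note fM = separably_measurable_space[OF assms(1)] separably_measurable_space[OF assms(2)]
  have "{y \<in> space Y. d (f y) (g y) < r} =
      (\<Union>z\<in>D. {y \<in> space Y. d z (f y) + d z (g y) < r})" (is "_ = ?S")
  proof
    have "d (f y) (g y) < r" if "z \<in> D" "y \<in> space Y" "d z (f y) + d z (g y) < r" for z y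
      using triangle''[of "f y" z "g y"] that D(2) fM by force
    then show "?S \<subseteq> {y \<in> space Y. d (f y) (g y) < r}" by auto
    show "{y \<in> space Y. d (f y) (g y) < r} \<subseteq> ?S"
    proof
      fix y assume y: "y \<in> {y \<in> space Y. d (f y) (g y) < r}"
      then obtain z where z: "z \<in> D" "d z (f y) < (r - d (f y) (g y)) / 2"
        using D(3)[rule_format, of y "(r - d (f y) (g y)) / 2"] by auto
      have "d z (g y) \<le> d z (f y) + d (f y) (g y)"
        using y z D fM by (intro triangle) auto
      then show "y \<in> ?S" using y z by (auto intro!: bexI[of _ z])
    qed
  qed
  also have "\<dots> \<in> sets Y"
    using D by (intro sets.countable_UN') auto
  finally show "{y \<in> space Y. d (f y) (g y) < r} \<in> sets Y" .
qed

lemma (in Metric_space) separably_measurable_countable_compose: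
  fixes f :: "'i::countable \<Rightarrow> 'y \<Rightarrow> 'a"
  assumes "\<And>i. f i \<in> separably_measurable Y M d" and k[measurable]: "k \<in> Y \<rightarrow>\<^sub>M count_space UNIV"
  shows "(\<lambda>y. f (k y) y) \<in> separably_measurable Y M d"
proof -
  have "\<forall>i. \<exists>D. countable D \<and> D \<subseteq> M \<and> (\<forall>y\<in>space Y. \<forall>e>0. \<exists>z\<in>D. d z (f i y) < e)"
    using assms(1) separably_measurable_iff[of "f i" Y for i] by simp
  then obtain D where D: "\<And>i. countable (D i)" "\<And>i. D i \<subseteq> M"
    "\<And>i y e. y\<in>space Y \<Longrightarrow> e>0 \<Longrightarrow> \<exists>z\<in>D i. d z (f i y) < e"
    by metis
  show ?thesis
  proof (rule separably_measurableI)
    show "countable (\<Union>i. D i)" "(\<Union>i. D i) \<subseteq> M" using D by auto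
    show "\<exists>z\<in>(\<Union>i. D i). d z (f (k y) y) < e" if "y \<in> space Y" "e > 0" for y e
      using D(3)[OF that, of "k y"] by blast
    show "(\<lambda>y. d z (f (k y) y)) \<in> borel_measurable Y" if "z \<in> M" for z
      using assms(1) that
      by (intro measurable_compose_countable[OF _ k, where f="\<lambda>i y. d z (f i y)"])
         (rule separably_measurable_mdist)
    show "f (k y) y \<in> M" if "y \<in> space Y" for y
      using separably_measurable_space[OF assms(1) that] .
  qed
qed

lemma (in Metric_space) separably_measurable_lim:
  fixes f :: "nat \<Rightarrow> 'y \<Rightarrow> 'a"
  assumes f: "\<And>n. f n \<in> separably_measurable Y M d"
    and g: "g \<in> space Y \<rightarrow> M"
    and lim: "\<And>y. y \<in> space Y \<Longrightarrow> (\<lambda>n. d (f n y) (g y)) \<longlonglongrightarrow> 0"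
  shows "g \<in> separably_measurable Y M d"
proof -
  have "\<forall>i. \<exists>D. countable D \<and> D \<subseteq> M \<and> (\<forall>y\<in>space Y. \<forall>e>0. \<exists>z\<in>D. d z (f i y) < e)"
    using assms(1) separably_measurable_iff[of "f i" Y for i] by simp
  then obtain D where D: "\<And>i. countable (D i)" "\<And>i. D i \<subseteq> M"
    "\<And>i y e. y\<in>space Y \<Longrightarrow> e>0 \<Longrightarrow> \<exists>z\<in>D i. d z (f i y) < e"
    by metis
  have fM: "f n y \<in> M" if "y \<in> space Y" for n y
    using separably_measurable_space[OF f that] .
  have "\<exists>z\<in>(\<Union>i. D i). d z (g y) < e" if y: "y\<in>space Y" and "e>0" for y e
  proof -
    have "\<forall>\<^sub>F n in sequentially. d (f n y) (g y) < e / 2"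
      using order_tendstoD(2)[OF lim[OF y], of "e / 2"] \<open>e > 0\<close> by simp
    then obtain n where n: "d (f n y) (g y) < e / 2"
      by (auto simp: eventually_sequentially)
    obtain z where z: "z \<in> D n" "d z (f n y) < e / 2"
      using D(3)[of y "e / 2" n] y \<open>e > 0\<close> by auto
    have "d z (g y) \<le> d z (f n y) + d (f n y) (g y)"
      using z D fM y g by (intro triangle) auto
    then show ?thesis using n z by (auto intro!: bexI[of _ z] exI[of _ n])
  qed
  moreover have "countable (\<Union>i. D i)" using D by simp
  moreover have "(\<Union>i. D i) \<subseteq> M" using D by auto
  moreover have "(\<lambda>y. d z (g y)) \<in> borel_measurable Y" if "z \<in> M" for z
  proof (rule borel_measurable_LIMSEQ_real)
    show "(\<lambda>y. d z (f n y)) \<in> borel_measurable Y" for n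
      using f that by (rule separably_measurable_mdist)
    show "(\<lambda>n. d z (f n y)) \<longlonglongrightarrow> d z (g y)" if y: "y \<in> space Y" for y
    proof -
      have "\<bar>d z (f n y) - d z (g y)\<bar> \<le> d (f n y) (g y)" for n
        using mdist_reverse_triangle[OF fM[OF y] \<open>z \<in> M\<close> Pi_mem[OF g y], of n]
        by (simp add: commute[of "f n y" z])
      then have "(\<lambda>n. d z (f n y) - d z (g y)) \<longlonglongrightarrow> 0"
        by (intro Lim_null_comparison[OF _ lim[OF y]] always_eventually) simp
      then show ?thesis by (simp add: LIM_zero_iff)
    qed
  qed
  moreover have "g y \<in> M" if "y \<in> space Y" for y using g that by auto
  ultimately show ?thesis
    by (intro separably_measurableI[where D="\<Union>i. D i"])
qed

section \<open>Strict convexity and the inequality of Minkowski\<close>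

text \<open>
The graph of \<open>x \<mapsto> x\<^sup>p\<close> lies strictly above its tangent at \<open>m\<close> apart from the point of contact, by
the mean value theorem and the monotonicity of the derivative.
\<close>

lemma powr_tangent_less:
  fixes X m p :: real
  assumes p: "1 < p" and m: "0 < m" and X: "0 \<le> X" "X \<noteq> m"
  shows "m powr p + p * m powr (p - 1) * (X - m) < X powr p"
proof -
  have cont: "continuous_on {u..v} (\<lambda>x. x powr p)" if "0 \<le> u" for u v
    using p that by (intro continuous_on_powr') (auto intro!: continuous_intros)
  have der: "((\<lambda>x. x powr p) has_real_derivative p * x powr (p - 1)) (at x)" if "x > 0" for x
    using that by (auto intro!: derivative_eq_intros)
  consider "X < m" | "m < X" using X by linarith
  then show ?thesis
  proof cases
    case 1
    obtain z where z: "X < z" "z < m" "m powr p - X powr p = (m - X) * (p * z powr (p - 1))"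
    proof -
      have "((\<lambda>x. x powr p) has_derivative (\<lambda>h. p * x powr (p - 1) * h)) (at x)" if "X < x" for x
        using der[of x] that X by (simp add: has_field_derivative_def)
      then obtain z where "X < z" "z < m" "m powr p - X powr p = p * z powr (p - 1) * (m - X)"
        using mvt[OF 1 cont[OF X(1)], of "\<lambda>x h. p * x powr (p - 1) * h"] by blast
      then show ?thesis by (intro that[of z]) (simp_all add: mult.commute)
    qed
    have "(m - X) * (p * z powr (p - 1)) < (m - X) * (p * m powr (p - 1))"
      using z p X 1 by (intro mult_strict_left_mono powr_less_mono2) auto
    then show ?thesis using z by (simp add: algebra_simps)
  next
    case 2
    obtain z where z: "m < z" "z < X" "X powr p - m powr p = (X - m) * (p * z powr (p - 1))"
      using MVT2[OF 2, of "\<lambda>x. x powr p" "\<lambda>x. p * x powr (p - 1)"] der m by auto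
    have "(X - m) * (p * m powr (p - 1)) < (X - m) * (p * z powr (p - 1))"
      using z p m 2 by (intro mult_strict_left_mono powr_less_mono2) auto
    then show ?thesis using z by (simp add: algebra_simps)
  qed
qed

text \<open>
Jensen's inequality for \<open>x \<mapsto> x\<^sup>p\<close> at the points \<open>u / l\<close> and \<open>v / (1 - l)\<close> with weights \<open>l\<close> and
\<open>1 - l\<close>, together with its case of equality.  Integrating it gives Minkowski's inequality, and
the right choice of \<open>l\<close> makes the integrated inequality sharp.
\<close>

lemma powr_add_le_weighted:
  fixes u v l p :: real
  assumes p: "1 < p" and l: "0 < l" "l < 1" and uv: "0 \<le> u" "0 \<le> v"
  shows "(u + v) powr p \<le> l powr (1 - p) * u powr p + (1 - l) powr (1 - p) * v powr p"
    and "(u + v) powr p = l powr (1 - p) * u powr p + (1 - l) powr (1 - p) * v powr p \<Longrightarrow>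
      u = l * (u + v)"
proof -
  define X where "X = u / l"
  define Y where "Y = v / (1 - l)"
  define m where "m = u + v"
  have m_eq: "m = l * X + (1 - l) * Y" using l by (simp add: m_def X_def Y_def)
  have XY: "X \<ge> 0" "Y \<ge> 0" using l uv by (auto simp: X_def Y_def)
  have split: "w powr (1 - p) * z powr p = w * (z / w) powr p" if "0 < w" "0 \<le> z" for w z
    using that by (simp add: powr_divide powr_diff)
  have eq: "l powr (1 - p) * u powr p + (1 - l) powr (1 - p) * v powr p
      = l * X powr p + (1 - l) * Y powr p"
    using split[of l u] split[of "1 - l" v] l uv by (simp add: X_def Y_def)
  have "m powr p \<le> l * X powr p + (1 - l) * Y powr p \<and>
    (m powr p = l * X powr p + (1 - l) * Y powr p \<longrightarrow> X = m)"
  proof (cases "m = 0")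
    case True
    then have "u = 0" "v = 0" using uv by (auto simp: m_def)
    then show ?thesis using p by (simp add: m_def X_def Y_def)
  next
    case False
    then have m: "m > 0" using uv by (auto simp: m_def)
    define T where "T Z = m powr p + p * m powr (p - 1) * (Z - m)" for Z
    have T: "T Z \<le> Z powr p" "T Z = Z powr p \<Longrightarrow> Z = m" if "Z \<ge> 0" for Z
      using powr_tangent_less[OF p m that] unfolding T_def by fastforce+
    \<comment> \<open>The weighted mean of \<open>X\<close> and \<open>Y\<close> is \<open>m\<close>, so the linear terms cancel.\<close>
    have "l * T X + (1 - l) * T Y = m powr p + p * m powr (p - 1) * (l * X + (1 - l) * Y - m)"
      by (simp add: T_def algebra_simps)
    then have comb: "l * T X + (1 - l) * T Y = m powr p" using m_eq by simp
    have 1: "l * T X \<le> l * X powr p" "(1 - l) * T Y \<le> (1 - l) * Y powr p"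
      using T XY l by (auto intro!: mult_left_mono)
    have "T X = X powr p" if "m powr p = l * X powr p + (1 - l) * Y powr p"
    proof -
      have "l * T X = l * X powr p" using 1 comb that by linarith
      then show ?thesis using l by simp
    qed
    then show ?thesis using 1 comb T(2)[OF XY(1)] by linarith
  qed
  then show "(u + v) powr p \<le> l powr (1 - p) * u powr p + (1 - l) powr (1 - p) * v powr p"
    and "(u + v) powr p = l powr (1 - p) * u powr p + (1 - l) powr (1 - p) * v powr p \<Longrightarrow>
      u = l * (u + v)"
    using eq l by (auto simp: m_def X_def field_simps)
qed

lemma nn_integral_weighted:
  fixes f g :: "'y \<Rightarrow> real"
  assumes [measurable]: "f \<in> borel_measurable Y" "g \<in> borel_measurable Y"
    and "0 \<le> s" "0 \<le> t" "\<And>y. 0 \<le> f y" "\<And>y. 0 \<le> g y"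
  shows "(\<integral>\<^sup>+ y. ennreal (s * f y + t * g y) \<partial>Y) =
    ennreal s * (\<integral>\<^sup>+ y. ennreal (f y) \<partial>Y) + ennreal t * (\<integral>\<^sup>+ y. ennreal (g y) \<partial>Y)"
  using assms by (simp add: ennreal_plus ennreal_mult nn_integral_add nn_integral_cmult)

text \<open>
If the norms of \<open>f\<close>, \<open>g\<close>, \<open>k\<close> are in the proportion \<open>l : 1 - l : 1\<close>, then Minkowski's inequality is an
equality.  The integrands in its proof are ordered pointwise and have the same finite integral,
so they agree almost everywhere, and strict convexity applies at each such point.
\<close>

lemma Minkowski_equality_AE:
  fixes f g k :: "'y \<Rightarrow> real"
  assumes p: "1 < p" and l: "0 < l" "l < 1" and K: "0 \<le> K"
    and [measurable]: "f \<in> borel_measurable Y" "g \<in> borel_measurable Y" "k \<in> borel_measurable Y"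
    and nonneg: "\<And>y. 0 \<le> f y" "\<And>y. 0 \<le> g y" "\<And>y. 0 \<le> k y"
    and le: "\<And>y. y \<in> space Y \<Longrightarrow> k y \<le> f y + g y"
    and f: "(\<integral>\<^sup>+ y. ennreal (f y powr p) \<partial>Y) = ennreal (l powr p * K)"
    and g: "(\<integral>\<^sup>+ y. ennreal (g y powr p) \<partial>Y) = ennreal ((1 - l) powr p * K)"
    and k: "(\<integral>\<^sup>+ y. ennreal (k y powr p) \<partial>Y) = ennreal K"
  shows "AE y in Y. f y = l * k y \<and> g y = (1 - l) * k y"
proof -
  define w where "w y = l powr (1 - p) * f y powr p + (1 - l) powr (1 - p) * g y powr p" for y
  have [measurable]: "w \<in> borel_measurable Y" unfolding w_def by measurable
  \<comment> \<open>The weights \<open>l\<^sup>1\<^sup>-\<^sup>p\<close> and \<open>(1 - l)\<^sup>1\<^sup>-\<^sup>p\<close> are chosen so that \<open>w\<close> has the integral of \<open>k\<^sup>p\<close>.\<close>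
  have cancel: "r powr (1 - p) * (r powr p * K) = r * K" if "r > 0" for r
    using that by (simp add: powr_diff)
  have "(\<integral>\<^sup>+ y. ennreal (w y) \<partial>Y) =
      ennreal (l powr (1 - p)) * ennreal (l powr p * K) +
      ennreal ((1 - l) powr (1 - p)) * ennreal ((1 - l) powr p * K)"
    unfolding w_def f[symmetric] g[symmetric] by (rule nn_integral_weighted) auto
  also have "\<dots> = ennreal (l * K + (1 - l) * K)"
    using K l by (simp add: ennreal_mult[symmetric] ennreal_plus[symmetric] cancel del: ennreal_plus)
  finally have w: "(\<integral>\<^sup>+ y. ennreal (w y) \<partial>Y) = ennreal K" by (simp add: algebra_simps)
  have w0: "0 \<le> w y" for y using nonneg by (simp add: w_def)
  have kfg: "k y powr p \<le> (f y + g y) powr p" if "y \<in> space Y" for y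
    using le[OF that] nonneg p by (intro powr_mono2) auto
  have fgw: "(f y + g y) powr p \<le> w y" for y
    unfolding w_def using p l nonneg by (intro powr_add_le_weighted) auto
  have "(\<integral>\<^sup>+ y. ennreal (w y) - ennreal (k y powr p) \<partial>Y)
      = (\<integral>\<^sup>+ y. ennreal (w y) \<partial>Y) - (\<integral>\<^sup>+ y. ennreal (k y powr p) \<partial>Y)"
    by (rule nn_integral_diff) (auto intro!: AE_I2 ennreal_leI order_trans[OF kfg fgw] simp: k)
  then have "(\<integral>\<^sup>+ y. ennreal (w y - k y powr p) \<partial>Y) = 0"
    using w k by (simp add: ennreal_minus)
  then have "AE y in Y. w y - k y powr p \<le> 0"
    by (subst (asm) nn_integral_0_iff_AE) (auto simp: ennreal_eq_0_iff)
  then have "AE y in Y. w y = k y powr p"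
  proof (rule AE_mp, intro AE_I2 impI)
    fix y assume "y \<in> space Y" "w y - k y powr p \<le> 0"
    then show "w y = k y powr p" using kfg[of y] fgw[of y] by linarith
  qed
  then show ?thesis
  proof (rule AE_mp, intro AE_I2 impI)
    fix y assume y: "y \<in> space Y" and eq: "w y = k y powr p"
    have "(f y + g y) powr p = w y" "k y powr p = (f y + g y) powr p"
      using kfg[OF y] fgw[of y] eq by linarith+
    then have "f y = l * (f y + g y)"
      using powr_add_le_weighted(2)[OF p l nonneg(1)[of y] nonneg(2)[of y]] unfolding w_def by simp
    moreover have "k y = f y + g y"
      using \<open>k y powr p = (f y + g y) powr p\<close> nonneg[of y] p
      by (metis add_nonneg_nonneg less_eq_real_def not_le powr_less_mono2 zero_less_one order_less_trans)
    ultimately show "f y = l * k y \<and> g y = (1 - l) * k y" by (simp add: algebra_simps)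
  qed
qed

text \<open>
The weight in the convexity inequality should be the share \<open>A / (A + B)\<close> of the norm of \<open>f\<close>; adding
\<open>e / 2\<close> to both norms keeps it strictly between 0 and 1.
\<close>

lemma Minkowski_nn_integral:
  fixes f g k :: "'y \<Rightarrow> real"
  assumes p: "1 < p"
    and [measurable]: "f \<in> borel_measurable Y" "g \<in> borel_measurable Y"
    and nonneg: "\<And>y. 0 \<le> f y" "\<And>y. 0 \<le> g y" "\<And>y. 0 \<le> k y"
    and le: "\<And>y. y \<in> space Y \<Longrightarrow> k y \<le> f y + g y"
    and f: "(\<integral>\<^sup>+ y. ennreal (f y powr p) \<partial>Y) < \<infinity>"
    and g: "(\<integral>\<^sup>+ y. ennreal (g y powr p) \<partial>Y) < \<infinity>"
  shows "enn2real (\<integral>\<^sup>+ y. ennreal (k y powr p) \<partial>Y) powr (1 / p) \<le>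
    enn2real (\<integral>\<^sup>+ y. ennreal (f y powr p) \<partial>Y) powr (1 / p) +
    enn2real (\<integral>\<^sup>+ y. ennreal (g y powr p) \<partial>Y) powr (1 / p)" (is "?K \<le> ?A + ?B")
proof (rule field_le_epsilon)
  fix e :: real assume "e > 0"
  define A where "A = ?A + e / 2"
  define B where "B = ?B + e / 2"
  have AB: "A > 0" "B > 0" using \<open>e > 0\<close> by (auto simp: A_def B_def add_nonneg_pos)
  define l where "l = A / (A + B)"
  have l: "0 < l" "l < 1" and l': "1 - l = B / (A + B)" using AB by (auto simp: l_def field_simps)
  have root: "enn2real I \<le> C powr p" if "enn2real I powr (1 / p) \<le> C" for I C
  proof -
    have "(enn2real I powr (1 / p)) powr p \<le> C powr p"
      using that p by (intro powr_mono2) auto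
    then show ?thesis using p by (simp add: powr_powr)
  qed
  have f': "(\<integral>\<^sup>+ y. ennreal (f y powr p) \<partial>Y) \<le> ennreal (A powr p)"
    using f root[of "\<integral>\<^sup>+ y. ennreal (f y powr p) \<partial>Y" A] \<open>e > 0\<close>
    by (metis A_def ennreal_enn2real ennreal_leI less_add_same_cancel1 half_gt_zero less_imp_le infinity_ennreal_def)
  have g': "(\<integral>\<^sup>+ y. ennreal (g y powr p) \<partial>Y) \<le> ennreal (B powr p)"
    using g root[of "\<integral>\<^sup>+ y. ennreal (g y powr p) \<partial>Y" B] \<open>e > 0\<close>
    by (metis B_def ennreal_enn2real ennreal_leI less_add_same_cancel1 half_gt_zero less_imp_le infinity_ennreal_def)
  have cancel: "(r / (A + B)) powr (1 - p) * r powr p = (r / (A + B)) * (A + B) powr p" if "r > 0" for r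
    using that AB by (simp add: powr_diff powr_divide)
  have "k y powr p \<le> l powr (1 - p) * f y powr p + (1 - l) powr (1 - p) * g y powr p"
    if "y \<in> space Y" for y
    using powr_add_le_weighted(1)[OF p l nonneg(1)[of y] nonneg(2)[of y]]
      powr_mono2[of p "k y" "f y + g y"] le[OF that] nonneg p by force
  then have "(\<integral>\<^sup>+ y. ennreal (k y powr p) \<partial>Y) \<le>
     (\<integral>\<^sup>+ y. ennreal (l powr (1 - p) * f y powr p + (1 - l) powr (1 - p) * g y powr p) \<partial>Y)"
    by (intro nn_integral_mono ennreal_leI)
  also have "\<dots> = ennreal (l powr (1 - p)) * (\<integral>\<^sup>+ y. ennreal (f y powr p) \<partial>Y) +
      ennreal ((1 - l) powr (1 - p)) * (\<integral>\<^sup>+ y. ennreal (g y powr p) \<partial>Y)"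
    by (rule nn_integral_weighted) auto
  also have "\<dots> \<le> ennreal (l powr (1 - p)) * ennreal (A powr p) +
      ennreal ((1 - l) powr (1 - p)) * ennreal (B powr p)"
    by (intro add_mono mult_left_mono f' g') auto
  also have "\<dots> = ennreal (A / (A + B) * (A + B) powr p + B / (A + B) * (A + B) powr p)"
    using AB l by (simp add: ennreal_mult[symmetric] ennreal_plus[symmetric] cancel l' l_def[symmetric]
        cancel[of A, folded l_def] del: ennreal_plus)
  also have "A / (A + B) * (A + B) powr p + B / (A + B) * (A + B) powr p = (A + B) powr p"
    unfolding distrib_right[symmetric] add_divide_distrib[symmetric] using AB by simp
  finally have "enn2real (\<integral>\<^sup>+ y. ennreal (k y powr p) \<partial>Y) \<le> (A + B) powr p"
    by (metis enn2real_leI powr_ge_zero)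
  then have "?K \<le> ((A + B) powr p) powr (1 / p)"
    using p by (intro powr_mono2) auto
  also have "\<dots> = A + B" using AB p by (simp add: powr_powr)
  finally show "?K \<le> ?A + ?B + e" by (simp add: A_def B_def)
qed

lemma nn_integral_powr_add_finite:
  fixes u v w :: "'y \<Rightarrow> real"
  assumes p: "0 \<le> p"
    and [measurable]: "u \<in> borel_measurable Y" "v \<in> borel_measurable Y"
    and nonneg: "\<And>y. 0 \<le> u y" "\<And>y. 0 \<le> v y" "\<And>y. 0 \<le> w y"
    and le: "\<And>y. y \<in> space Y \<Longrightarrow> w y \<le> u y + v y"
    and fin: "(\<integral>\<^sup>+ y. ennreal (u y powr p) \<partial>Y) < \<infinity>" "(\<integral>\<^sup>+ y. ennreal (v y powr p) \<partial>Y) < \<infinity>"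
  shows "(\<integral>\<^sup>+ y. ennreal (w y powr p) \<partial>Y) < \<infinity>"
proof -
  have "w y powr p \<le> 2 powr p * u y powr p + 2 powr p * v y powr p" if "y \<in> space Y" for y
  proof -
    have "w y powr p \<le> (2 * max (u y) (v y)) powr p"
      using le[OF that] nonneg p by (intro powr_mono2) auto
    also have "\<dots> = 2 powr p * max (u y) (v y) powr p"
      using nonneg by (simp add: powr_mult max_def)
    also have "\<dots> \<le> 2 powr p * (u y powr p + v y powr p)"
      by (intro mult_left_mono) (auto simp: max_def)
    finally show ?thesis by (simp add: distrib_left)
  qed
  then have "(\<integral>\<^sup>+ y. ennreal (w y powr p) \<partial>Y) \<le>
      (\<integral>\<^sup>+ y. ennreal (2 powr p * u y powr p + 2 powr p * v y powr p) \<partial>Y)"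
    by (intro nn_integral_mono ennreal_leI)
  also have "\<dots> = ennreal (2 powr p) * (\<integral>\<^sup>+ y. ennreal (u y powr p) \<partial>Y) +
      ennreal (2 powr p) * (\<integral>\<^sup>+ y. ennreal (v y powr p) \<partial>Y)"
    by (rule nn_integral_weighted) auto
  also have "\<dots> < \<infinity>" using fin by (simp add: ennreal_mult_less_top)
  finally show ?thesis .
qed

section \<open>The product outer measure\<close>

lemma rect_outer_le:
  assumes "range S \<subseteq> sets A" "range T \<subseteq> sets B" "E \<subseteq> (\<Union>i::nat. S i \<times> T i)"
  shows "rect_outer A B E \<le> (\<Sum>i. emeasure A (S i) * emeasure B (T i))"
  unfolding rect_outer_def by (rule INF_lower2[of "(S, T)"]) (use assms in auto)

lemma rect_outer_cover:
  assumes "rect_outer A B E < c"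
  obtains S T where "range S \<subseteq> sets A" "range T \<subseteq> sets B" "E \<subseteq> (\<Union>i::nat. S i \<times> T i)"
    "(\<Sum>i. emeasure A (S i) * emeasure B (T i)) < c"
  using assms unfolding rect_outer_def INF_less_iff by auto

lemma rect_outer_mono: "E \<subseteq> F \<Longrightarrow> rect_outer A B E \<le> rect_outer A B F"
  unfolding rect_outer_def by (rule INF_superset_mono) auto

lemma rect_outer_times_le:
  assumes "S \<in> sets A" "T \<in> sets B"
  shows "rect_outer A B (S \<times> T) \<le> emeasure A S * emeasure B T"
proof -
  define S' where "S' i = (if i = 0 then S else {})" for i :: nat
  define T' where "T' i = (if i = 0 then T else {})" for i :: nat
  have "rect_outer A B (S \<times> T) \<le> (\<Sum>i. emeasure A (S' i) * emeasure B (T' i))"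
    by (rule rect_outer_le) (use assms in \<open>auto simp: S'_def T'_def\<close>)
  also have "\<dots> = (\<Sum>i\<in>{0}. emeasure A (S' i) * emeasure B (T' i))"
    by (rule suminf_finite) (auto simp: S'_def)
  finally show ?thesis by (simp add: S'_def T'_def)
qed

lemma rect_outer_empty [simp]: "rect_outer A B {} = 0"
  using rect_outer_times_le[of "{}" A "{}" B] by simp

text \<open>
Covers of the \<open>E i\<close> that are optimal up to \<open>e / 2\<^sup>i\<^sup>+\<^sup>1\<close> are enumerated as a single cover of the union.
\<close>

lemma rect_outer_countably_subadditive:
  "rect_outer A B (\<Union>i::nat. E i) \<le> (\<Sum>i. rect_outer A B (E i))"
proof (rule ennreal_le_epsilon)
  fix e :: real assume e: "e > 0" and fin: "(\<Sum>i. rect_outer A B (E i)) < top"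
  have e': "ennreal (e * (1/2)^Suc i) > 0" for i using e by simp
  define cover where "cover i C \<longleftrightarrow> range (fst C) \<subseteq> sets A \<and> range (snd C) \<subseteq> sets B \<and>
      E i \<subseteq> (\<Union>j::nat. fst C j \<times> snd C j) \<and>
      (\<Sum>j. emeasure A (fst C j) * emeasure B (snd C j)) < rect_outer A B (E i) + ennreal (e * (1/2)^Suc i)"
    for i C
  have "\<exists>C. cover i C" for i
  proof -
    have "rect_outer A B (E i) < top"
      using fin by (metis ennreal_suminf_lessD)
    then have "rect_outer A B (E i) < rect_outer A B (E i) + ennreal (e * (1/2)^Suc i)"
      using e' by (simp add: ennreal_add_left_cancel_less[of _ 0, simplified])
    then obtain S T where "cover i (S, T)"
      unfolding cover_def fst_conv snd_conv by (rule rect_outer_cover) blast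
    then show ?thesis ..
  qed
  then obtain C where C: "\<And>i. cover i (C i)" by metis
  define S where "S i = fst (C i)" for i
  define T where "T i = snd (C i)" for i
  have ST: "\<And>i. range (S i) \<subseteq> sets A" "\<And>i. range (T i) \<subseteq> sets B"
    "\<And>i. E i \<subseteq> (\<Union>j::nat. S i j \<times> T i j)"
    and le: "\<And>i. (\<Sum>j. emeasure A (S i j) * emeasure B (T i j)) \<le>
        rect_outer A B (E i) + ennreal (e * (1/2)^Suc i)"
    using C unfolding cover_def S_def T_def by (simp_all add: less_imp_le)
  define F where "F = (\<lambda>(i, j). emeasure A (S i j) * emeasure B (T i j))"
  have "rect_outer A B (\<Union>i::nat. E i) \<le> (\<Sum>k. emeasure A (case_prod S (prod_decode k)) *
      emeasure B (case_prod T (prod_decode k)))"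
  proof (rule rect_outer_le)
    show "range (\<lambda>k. case_prod S (prod_decode k)) \<subseteq> sets A"
      "range (\<lambda>k. case_prod T (prod_decode k)) \<subseteq> sets B"
      using ST(1,2) by (auto split: prod.split simp: image_subset_iff)
    show "(\<Union>i. E i) \<subseteq> (\<Union>k. case_prod S (prod_decode k) \<times> case_prod T (prod_decode k))"
    proof
      fix z assume "z \<in> (\<Union>i. E i)"
      then obtain i j where "z \<in> S i j \<times> T i j" using ST(3) by blast
      then show "z \<in> (\<Union>k. case_prod S (prod_decode k) \<times> case_prod T (prod_decode k))"
        by (intro UN_I[of "prod_encode (i, j)"]) auto
    qed
  qed
  also have "\<dots> = (\<Sum>k. F (prod_decode k))"
    by (simp add: F_def case_prod_beta)
  also have "\<dots> = (\<Sum>i. \<Sum>j. emeasure A (S i j) * emeasure B (T i j))"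
    using suminf_ennreal_2dimen[of "\<lambda>i. \<Sum>j. emeasure A (S i j) * emeasure B (T i j)" F]
    by (simp add: F_def comp_def)
  also have "\<dots> \<le> (\<Sum>i. rect_outer A B (E i) + ennreal (e * (1/2)^Suc i))"
    by (intro suminf_le le) auto
  also have "\<dots> = (\<Sum>i. rect_outer A B (E i)) + (\<Sum>i. ennreal (e * (1/2)^Suc i))"
    by (rule suminf_add[symmetric]) auto
  also have "(\<Sum>i. ennreal (e * (1/2)^Suc i)) = ennreal e"
    using e sums_mult[OF power_half_series, of e] by (intro suminf_ennreal_eq) auto
  finally show "rect_outer A B (\<Union>i. E i) \<le> (\<Sum>i. rect_outer A B (E i)) + ennreal e" .
qed

lemma rect_outer_Un_le: "rect_outer A B (E \<union> F) \<le> rect_outer A B E + rect_outer A B F"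
proof -
  define G where "G i = (if i = 0 then E else if i = 1 then F else {})" for i :: nat
  have "rect_outer A B (\<Union>i. G i) \<le> (\<Sum>i. rect_outer A B (G i))"
    by (rule rect_outer_countably_subadditive)
  also have "(\<Union>i. G i) = E \<union> F" by (auto simp: G_def split: if_splits)
  also have "(\<Sum>i. rect_outer A B (G i)) = (\<Sum>i\<in>{0, 1}. rect_outer A B (G i))"
    by (rule suminf_finite) (auto simp: G_def)
  finally show ?thesis by (simp add: G_def)
qed

lemma outer_measure_space_rect_outer:
  "outer_measure_space (Pow (space A \<times> space B)) (rect_outer A B)"
  by (auto simp: outer_measure_space_def positive_def increasing_def countably_subadditive_def
      intro: rect_outer_mono rect_outer_countably_subadditive)

lemma measure_space_lambda_system_rect_outer:
  "measure_space (space A \<times> space B)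
     (lambda_system (space A \<times> space B) (Pow (space A \<times> space B)) (rect_outer A B)) (rect_outer A B)"
  using sigma_algebra.caratheodory_lemma[OF sigma_algebra_Pow outer_measure_space_rect_outer] .

lemma space_prod_caratheodory: "space (prod_caratheodory A B) = space A \<times> space B"
  unfolding prod_caratheodory_def by (rule space_measure_of) (auto simp: lambda_system_def)

lemma sets_prod_caratheodory: "sets (prod_caratheodory A B) =
    lambda_system (space A \<times> space B) (Pow (space A \<times> space B)) (rect_outer A B)"
  using measure_space_lambda_system_rect_outer[of A B]
  by (simp add: prod_caratheodory_def measure_space_def sigma_algebra.sets_measure_of_eq)

lemma emeasure_prod_caratheodory:
  assumes "E \<in> sets (prod_caratheodory A B)"
  shows "emeasure (prod_caratheodory A B) E = rect_outer A B E"
  using measure_space_lambda_system_rect_outer[of A B] assms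
  unfolding sets_prod_caratheodory
  by (simp add: prod_caratheodory_def measure_space_def emeasure_measure_of_sigma)

text \<open>
Cutting each rectangle of a cover along \<open>S\<close> and \<open>T\<close> yields rectangles covering the two parts of
the set, with the same total measure.
\<close>

lemma times_in_sets_prod_caratheodory:
  assumes S: "S \<in> sets A" and T: "T \<in> sets B"
  shows "S \<times> T \<in> sets (prod_caratheodory A B)"
proof -
  let ?\<Omega> = "space A \<times> space B"
  have R: "S \<times> T \<subseteq> ?\<Omega>" using sets.sets_into_space[OF S] sets.sets_into_space[OF T] by auto
  have ge: "rect_outer A B ((S \<times> T) \<inter> X) + rect_outer A B ((?\<Omega> - S \<times> T) \<inter> X) \<le> rect_outer A B X" for X
    unfolding rect_outer_def[of A B X]
  proof (rule INF_greatest, safe)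
    fix P Q assume P: "range P \<subseteq> sets A" and Q: "range Q \<subseteq> sets B" and X: "X \<subseteq> (\<Union>i::nat. P i \<times> Q i)"
    note [measurable] = S T
    have [measurable]: "P i \<in> sets A" "Q i \<in> sets B" for i using P Q by auto
    have 1: "rect_outer A B ((S \<times> T) \<inter> X) \<le> (\<Sum>i. emeasure A (P i \<inter> S) * emeasure B (Q i \<inter> T))"
      by (rule rect_outer_le) (use X in auto)
    have "rect_outer A B ((?\<Omega> - S \<times> T) \<inter> X) \<le>
        rect_outer A B ((?\<Omega> - S \<times> T) \<inter> X \<inter> (S \<times> UNIV)) + rect_outer A B ((?\<Omega> - S \<times> T) \<inter> X - (S \<times> UNIV))"
      by (rule order_trans[OF rect_outer_mono rect_outer_Un_le]) auto
    also have "\<dots> \<le> (\<Sum>i. emeasure A (P i \<inter> S) * emeasure B (Q i - T)) +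
        (\<Sum>i. emeasure A (P i - S) * emeasure B (Q i))"
    proof (rule add_mono)
      show "rect_outer A B ((?\<Omega> - S \<times> T) \<inter> X \<inter> (S \<times> UNIV)) \<le>
          (\<Sum>i. emeasure A (P i \<inter> S) * emeasure B (Q i - T))"
        by (rule rect_outer_le) (use X in auto)
      show "rect_outer A B ((?\<Omega> - S \<times> T) \<inter> X - (S \<times> UNIV)) \<le>
          (\<Sum>i. emeasure A (P i - S) * emeasure B (Q i))"
        by (rule rect_outer_le) (use X in auto)
    qed
    finally have "rect_outer A B ((S \<times> T) \<inter> X) + rect_outer A B ((?\<Omega> - S \<times> T) \<inter> X) \<le>
        (\<Sum>i. emeasure A (P i \<inter> S) * emeasure B (Q i \<inter> T)) +
        ((\<Sum>i. emeasure A (P i \<inter> S) * emeasure B (Q i - T)) +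
        (\<Sum>i. emeasure A (P i - S) * emeasure B (Q i)))"
      using 1 by (intro add_mono)
    also have "\<dots> = (\<Sum>i. emeasure A (P i \<inter> S) * emeasure B (Q i \<inter> T) +
        (emeasure A (P i \<inter> S) * emeasure B (Q i - T) + emeasure A (P i - S) * emeasure B (Q i)))"
      by (simp add: suminf_add)
    also have "\<dots> = (\<Sum>i. emeasure A (P i) * emeasure B (Q i))"
    proof (rule suminf_cong)
      fix i
      have B: "emeasure B (Q i) = emeasure B (Q i \<inter> T) + emeasure B (Q i - T)"
        by (subst plus_emeasure) (auto simp: Int_Diff_Un)
      have A: "emeasure A (P i) = emeasure A (P i \<inter> S) + emeasure A (P i - S)"
        by (subst plus_emeasure) (auto simp: Int_Diff_Un)
      show "emeasure A (P i \<inter> S) * emeasure B (Q i \<inter> T) +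
        (emeasure A (P i \<inter> S) * emeasure B (Q i - T) + emeasure A (P i - S) * emeasure B (Q i))
        = emeasure A (P i) * emeasure B (Q i)"
        unfolding A B by (simp add: algebra_simps)
    qed
    finally show "rect_outer A B (S \<times> T \<inter> X) + rect_outer A B ((?\<Omega> - S \<times> T) \<inter> X)
       \<le> (\<Sum>i. emeasure A (P i) * emeasure B (Q i))" .
  qed
  have le: "rect_outer A B X \<le> rect_outer A B ((S \<times> T) \<inter> X) + rect_outer A B ((?\<Omega> - S \<times> T) \<inter> X)"
    if "X \<subseteq> ?\<Omega>" for X
    by (rule order_trans[OF rect_outer_mono rect_outer_Un_le]) (use that in blast)
  show ?thesis
    unfolding sets_prod_caratheodory lambda_system_def
    using R by (auto intro!: antisym ge le)
qed

lemma measurable_fst_prod_caratheodory: "fst \<in> prod_caratheodory A B \<rightarrow>\<^sub>M A"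
proof (rule measurableI)
  fix S assume S: "S \<in> sets A"
  then have "fst -` S \<inter> space (prod_caratheodory A B) = S \<times> space B"
    using sets.sets_into_space[OF S] by (auto simp: space_prod_caratheodory)
  then show "fst -` S \<inter> space (prod_caratheodory A B) \<in> sets (prod_caratheodory A B)"
    using S by (simp add: times_in_sets_prod_caratheodory)
qed (auto simp: space_prod_caratheodory)

lemma measurable_snd_prod_caratheodory: "snd \<in> prod_caratheodory A B \<rightarrow>\<^sub>M B"
proof (rule measurableI)
  fix T assume T: "T \<in> sets B"
  then have "snd -` T \<inter> space (prod_caratheodory A B) = space A \<times> T"
    using sets.sets_into_space[OF T] by (auto simp: space_prod_caratheodory)
  then show "snd -` T \<inter> space (prod_caratheodory A B) \<in> sets (prod_caratheodory A B)"
    using T by (simp add: times_in_sets_prod_caratheodory)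
qed (auto simp: space_prod_caratheodory)

lemma emeasure_times_prod_caratheodory_le:
  assumes "S \<in> sets A" "T \<in> sets B"
  shows "emeasure (prod_caratheodory A B) (S \<times> T) \<le> emeasure A S * emeasure B T"
  using assms
  by (simp add: emeasure_prod_caratheodory times_in_sets_prod_caratheodory rect_outer_times_le)

text \<open>
The exceptional set is \<open>space A \<times> Z\<close> with \<open>Z\<close> null.  Its measure is at most
\<open>emeasure A (space A) * 0\<close>, which is 0 even if the first factor is infinite.
\<close>

lemma AE_prod_caratheodory_snd:
  assumes "AE y in B. P y"
  shows "AE z in prod_caratheodory A B. P (snd z)"
proof -
  obtain Z where Z: "{y \<in> space B. \<not> P y} \<subseteq> Z" "Z \<in> sets B" "emeasure B Z = 0"
    using assms by (auto elim!: AE_E)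
  have "emeasure (prod_caratheodory A B) (space A \<times> Z) \<le> emeasure A (space A) * emeasure B Z"
    by (rule emeasure_times_prod_caratheodory_le) (use Z in auto)
  then have "space A \<times> Z \<in> null_sets (prod_caratheodory A B)"
    using Z times_in_sets_prod_caratheodory[of "space A" A Z B] by (simp add: null_sets_def)
  then show ?thesis
    by (rule AE_I') (use Z(1) in \<open>auto simp: space_prod_caratheodory\<close>)
qed

text \<open>
The image of the product measure under \<open>snd\<close> is dominated by a multiple of \<open>B\<close>.
\<close>

lemma nn_integral_prod_caratheodory_snd_le:
  assumes [measurable]: "g \<in> borel_measurable B"
  shows "(\<integral>\<^sup>+ z. g (snd z) \<partial>prod_caratheodory A B) \<le> emeasure A (space A) * (\<integral>\<^sup>+ y. g y \<partial>B)"
proof -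
  let ?D = "distr (prod_caratheodory A B) B snd"
  have "emeasure ?D T \<le> emeasure (scale_measure (emeasure A (space A)) B) T" for T
  proof (cases "T \<in> sets B")
    case True
    then have "snd -` T \<inter> space (prod_caratheodory A B) = space A \<times> T"
      using sets.sets_into_space[OF True] by (auto simp: space_prod_caratheodory)
    then show ?thesis
      using True by (simp add: emeasure_distr measurable_snd_prod_caratheodory
          emeasure_times_prod_caratheodory_le)
  qed (simp add: emeasure_notin_sets)
  then have "?D \<le> scale_measure (emeasure A (space A)) B"
    by (simp add: le_measure_iff le_fun_def space_scale_measure)
  then have "nn_integral ?D g \<le> nn_integral (scale_measure (emeasure A (space A)) B) g"
    by (intro nn_integral_mono_measure) auto
  then show ?thesis
    by (simp add: nn_integral_distr measurable_snd_prod_caratheodory nn_integral_scale_measure)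
qed

section \<open>Null sets of the product and their sections\<close>

text \<open>
Applied also to the swapped set, this inequality makes the two coordinates interchangeable.
\<close>

lemma rect_outer_swap_le: "rect_outer B A (prod.swap ` E) \<le> rect_outer A B E"
  unfolding rect_outer_def[of A]
proof (rule INF_greatest, safe)
  fix S T assume ST: "range S \<subseteq> sets A" "range T \<subseteq> sets B" "E \<subseteq> (\<Union>i::nat. S i \<times> T i)"
  have "prod.swap ` E \<subseteq> (\<Union>i. T i \<times> S i)" using ST(3) by fastforce
  then have "rect_outer B A (prod.swap ` E) \<le> (\<Sum>i. emeasure B (T i) * emeasure A (S i))"
    by (rule rect_outer_le[OF ST(2,1)])
  then show "rect_outer B A (prod.swap ` E) \<le> (\<Sum>i. emeasure A (S i) * emeasure B (T i))"
    by (simp add: mult.commute)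
qed

text \<open>
The integrand bounds the measure of the section at \<open>x\<close> of the union of the rectangles; see the
next lemma.
\<close>

lemma nn_integral_sections:
  fixes S :: "nat \<Rightarrow> 'x set" and T :: "nat \<Rightarrow> 'y set"
  assumes "range S \<subseteq> sets A" "range T \<subseteq> sets B"
  shows "(\<integral>\<^sup>+ x. (\<Sum>i. indicator (S i) x * emeasure B (T i)) \<partial>A) =
    (\<Sum>i. emeasure A (S i) * emeasure B (T i))"
proof -
  have [measurable]: "S i \<in> sets A" "T i \<in> sets B" for i using assms by auto
  show ?thesis by (simp add: nn_integral_suminf nn_integral_multc)
qed

lemma emeasure_section_le:
  fixes S :: "nat \<Rightarrow> 'x set" and T :: "nat \<Rightarrow> 'y set"
  assumes "range T \<subseteq> sets B"
  shows "emeasure B (\<Union>i\<in>{i. x \<in> S i}. T i) \<le> (\<Sum>i. indicator (S i) x * emeasure B (T i))"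
proof -
  define Q where "Q i = (if x \<in> S i then T i else {})" for i
  have "(\<Union>i\<in>{i. x \<in> S i}. T i) = (\<Union>i. Q i)" by (auto simp: Q_def split: if_splits)
  moreover have "emeasure B (\<Union>i. Q i) \<le> (\<Sum>i. emeasure B (Q i))"
    by (rule emeasure_subadditive_countably) (use assms in \<open>auto simp: Q_def\<close>)
  moreover have "emeasure B (Q i) = indicator (S i) x * emeasure B (T i)" for i
    by (simp add: Q_def)
  ultimately show ?thesis by simp
qed

text \<open>
For covers of \<open>E\<close> with total measure tending to 0, the bounds \<open>\<phi>\<^sub>n\<close> on the sections have integrals
tending to 0.  Hence their infimum vanishes almost everywhere.
\<close>

lemma rect_outer_null_sections:
  assumes "rect_outer A B E = 0"
  shows "AE x in A. AE y in B. (x, y) \<notin> E"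
proof -
  define cover where "cover n C \<longleftrightarrow> range (fst C) \<subseteq> sets A \<and> range (snd C) \<subseteq> sets B \<and>
      E \<subseteq> (\<Union>j::nat. fst C j \<times> snd C j) \<and>
      (\<Sum>j. emeasure A (fst C j) * emeasure B (snd C j)) < ennreal (1 / Suc n)"
    for n :: nat and C
  have "\<exists>C. cover n C" for n
  proof -
    have "rect_outer A B E < ennreal (1 / Suc n)" using assms by simp
    then obtain S T where "cover n (S, T)"
      unfolding cover_def fst_conv snd_conv by (rule rect_outer_cover) blast
    then show ?thesis ..
  qed
  then obtain C where C: "\<And>n. cover n (C n)" by metis
  define S where "S n = fst (C n)" for n
  define T where "T n = snd (C n)" for n
  have ST: "\<And>n. range (S n) \<subseteq> sets A" "\<And>n. range (T n) \<subseteq> sets B"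
    "\<And>n. E \<subseteq> (\<Union>j::nat. S n j \<times> T n j)"
    and le: "\<And>n. (\<Sum>j. emeasure A (S n j) * emeasure B (T n j)) < ennreal (1 / Suc n)"
    using C unfolding cover_def S_def T_def by simp_all
  have [measurable]: "S n i \<in> sets A" "T n i \<in> sets B" for n i using ST by auto
  define \<phi> where "\<phi> n x = (\<Sum>i. indicator (S n i) x * emeasure B (T n i))" for n x
  have [measurable]: "\<phi> n \<in> borel_measurable A" for n unfolding \<phi>_def by measurable
  have int: "(\<integral>\<^sup>+ x. (INF n. \<phi> n x) \<partial>A) \<le> ennreal (1 / Suc n)" for n
  proof -
    have "(\<integral>\<^sup>+ x. (INF n. \<phi> n x) \<partial>A) \<le> (\<integral>\<^sup>+ x. \<phi> n x \<partial>A)"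
      by (intro nn_integral_mono INF_lower) auto
    also have "\<dots> \<le> ennreal (1 / Suc n)"
      using le[of n] unfolding \<phi>_def by (simp add: nn_integral_sections[OF ST(1,2)])
    finally show ?thesis .
  qed
  have "(\<integral>\<^sup>+ x. (INF n. \<phi> n x) \<partial>A) = 0"
  proof (rule antisym[OF ennreal_le_epsilon])
    fix e :: real assume "e > 0"
    then obtain n :: nat where "1 / Suc n < e" by (rule nat_approx_posE)
    then show "(\<integral>\<^sup>+ x. (INF n. \<phi> n x) \<partial>A) \<le> 0 + ennreal e"
      using order_trans[OF int[of n] ennreal_leI[of "1 / Suc n" e]] by simp
  qed simp
  then have "AE x in A. (INF n. \<phi> n x) = 0" by (simp add: nn_integral_0_iff_AE)
  then show ?thesis
  proof eventually_elim
    case x: (elim x)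
    define Z where "Z = (\<Inter>n. \<Union>i\<in>{i. x \<in> S n i}. T n i)"
    have [measurable]: "(\<Union>i\<in>{i. x \<in> S n i}. T n i) \<in> sets B" for n by measurable
    have Z: "Z \<in> sets B" unfolding Z_def by measurable
    have "emeasure B Z \<le> \<phi> n x" for n
    proof -
      have "emeasure B Z \<le> emeasure B (\<Union>i\<in>{i. x \<in> S n i}. T n i)"
        by (rule emeasure_mono) (auto simp: Z_def)
      also have "\<dots> \<le> \<phi> n x"
        unfolding \<phi>_def by (rule emeasure_section_le[OF ST(2)])
      finally show ?thesis .
    qed
    then have "emeasure B Z \<le> (INF n. \<phi> n x)" by (simp add: le_INF_iff)
    then have "emeasure B Z = 0" using x by simp
    then have "Z \<in> null_sets B" using Z by (simp add: null_sets_def)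
    moreover have "{y \<in> space B. \<not> (x, y) \<notin> E} \<subseteq> Z"
      using ST(3) unfolding Z_def by blast
    ultimately show ?case by (rule AE_I')
  qed
qed

text \<open>
A null set of the product has null sections in both directions, because the outer measure treats
the two factors alike.
\<close>

lemma AE_prod_caratheodory_sections:
  assumes "AE z in prod_caratheodory A B. P z"
  shows "AE x in A. AE y in B. P (x, y)" "AE y in B. AE x in A. P (x, y)"
proof -
  obtain E where E: "{z \<in> space A \<times> space B. \<not> P z} \<subseteq> E" "rect_outer A B E = 0"
    using assms by (auto elim!: AE_E simp: emeasure_prod_caratheodory space_prod_caratheodory)
  have "AE x in A. x \<in> space A" "AE y in B. y \<in> space B" by simp_all
  note sp = this
  have 1: "AE x in A. AE y in B. (x, y) \<notin> E" by (rule rect_outer_null_sections[OF E(2)])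
  show "AE x in A. AE y in B. P (x, y)"
    using 1 sp(1)
  proof eventually_elim
    case (elim x)
    from elim(1) sp(2) show ?case
      by eventually_elim (use elim(2) E(1) in auto)
  qed
  have 2: "AE y in B. AE x in A. (y, x) \<notin> prod.swap ` E"
  proof (rule rect_outer_null_sections)
    show "rect_outer B A (prod.swap ` E) = 0"
      using rect_outer_swap_le[of B A E] E by simp
  qed
  show "AE y in B. AE x in A. P (x, y)"
    using 2 sp(2)
  proof eventually_elim
    case (elim y)
    from elim(1) sp(1) show ?case
      by eventually_elim (use elim(2) E(1) in force)
  qed
qed

text \<open>
One half of Tonelli's theorem for a rectangle with finitely many rectangles removed, by
induction on their number.  Removing the last rectangle \<open>S n \<times> T n\<close> splits \<open>P \<times> Q\<close> into
\<open>(P - S n) \<times> Q\<close> and \<open>(P \<inter> S n) \<times> (Q - T n)\<close>, which is why \<open>P\<close> and \<open>Q\<close> must be arbitrary.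
\<close>

lemma rect_outer_diff_rects_le:
  fixes S :: "nat \<Rightarrow> 'x set" and T :: "nat \<Rightarrow> 'y set"
  assumes S[measurable]: "\<And>i. S i \<in> sets A" and T[measurable]: "\<And>i. T i \<in> sets B"
    and "P \<in> sets A" "Q \<in> sets B"
  shows "(\<lambda>x. emeasure B (Q - (\<Union>i\<in>{i. i < n \<and> x \<in> S i}. T i))) \<in> borel_measurable A \<and>
    rect_outer A B (P \<times> Q - (\<Union>i<n. S i \<times> T i)) \<le>
      (\<integral>\<^sup>+ x. indicator P x * emeasure B (Q - (\<Union>i\<in>{i. i < n \<and> x \<in> S i}. T i)) \<partial>A)"
  using assms(3,4)
proof (induction n arbitrary: P Q)
  case 0
  then show ?case by (simp add: rect_outer_times_le nn_integral_multc)
next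
  case (Suc n)
  note [measurable] = Suc.prems
  define g where "g R x = emeasure B (R - (\<Union>i\<in>{i. i < n \<and> x \<in> S i}. T i))" for R x
  have IH: "g R \<in> borel_measurable A"
    "rect_outer A B (P' \<times> R - (\<Union>i<n. S i \<times> T i)) \<le> (\<integral>\<^sup>+ x. indicator P' x * g R x \<partial>A)"
    if "P' \<in> sets A" "R \<in> sets B" for P' R
    using Suc.IH[OF that] unfolding g_def by auto
  have [measurable]: "g Q \<in> borel_measurable A" "g (Q - T n) \<in> borel_measurable A"
    by (rule IH; measurable)+
  have step: "emeasure B (Q - (\<Union>i\<in>{i. i < Suc n \<and> x \<in> S i}. T i)) =
      (if x \<in> S n then g (Q - T n) x else g Q x)" for x
    unfolding g_def by (auto intro!: arg_cong[where f="emeasure B"] simp: less_Suc_eq)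
  have "rect_outer A B (P \<times> Q - (\<Union>i<Suc n. S i \<times> T i)) \<le>
      rect_outer A B ((P - S n) \<times> Q - (\<Union>i<n. S i \<times> T i)) +
      rect_outer A B ((P \<inter> S n) \<times> (Q - T n) - (\<Union>i<n. S i \<times> T i))"
    by (rule order_trans[OF rect_outer_mono rect_outer_Un_le]) (auto simp: less_Suc_eq)
  also have "\<dots> \<le> (\<integral>\<^sup>+ x. indicator (P - S n) x * g Q x \<partial>A) +
      (\<integral>\<^sup>+ x. indicator (P \<inter> S n) x * g (Q - T n) x \<partial>A)"
    by (intro add_mono IH) measurable
  also have "\<dots> = (\<integral>\<^sup>+ x. indicator (P - S n) x * g Q x + indicator (P \<inter> S n) x * g (Q - T n) x \<partial>A)"
    by (rule nn_integral_add[symmetric]) measurable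
  also have "\<dots> = (\<integral>\<^sup>+ x. indicator P x * (if x \<in> S n then g (Q - T n) x else g Q x) \<partial>A)"
    by (rule nn_integral_cong) (auto split: split_indicator)
  finally show ?case unfolding step by simp
qed

text \<open>
The union is made disjoint by removing from each rectangle the earlier ones.
\<close>

lemma rect_outer_UN_le:
  fixes S :: "nat \<Rightarrow> 'x set" and T :: "nat \<Rightarrow> 'y set"
  assumes S[measurable]: "\<And>i. S i \<in> sets A" and T[measurable]: "\<And>i. T i \<in> sets B"
  shows "rect_outer A B (\<Union>i. S i \<times> T i) \<le> (\<integral>\<^sup>+ x. emeasure B (\<Union>i\<in>{i. x \<in> S i}. T i) \<partial>A)"
proof -
  define g where "g n x = indicator (S n) x * emeasure B (T n - (\<Union>i\<in>{i. i < n \<and> x \<in> S i}. T i))" for n x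
  have g: "g n \<in> borel_measurable A"
    "rect_outer A B (S n \<times> T n - (\<Union>i<n. S i \<times> T i)) \<le> (\<integral>\<^sup>+ x. g n x \<partial>A)" for n
    using rect_outer_diff_rects_le[of S A T B "S n" "T n" n] unfolding g_def by auto
  have sum: "(\<Sum>n. g n x) = emeasure B (\<Union>i\<in>{i. x \<in> S i}. T i)" for x
  proof -
    define Q where "Q i = (if x \<in> S i then T i else {})" for i
    have "emeasure B (disjointed Q n) = g n x" for n
      unfolding disjointed_def g_def Q_def
      by (auto intro!: arg_cong[where f="emeasure B"] split: if_splits split_indicator)
    moreover have "range (disjointed Q) \<subseteq> sets B"
      by (rule sets.range_disjointed_sets) (auto simp: Q_def)
    then have "(\<Sum>n. emeasure B (disjointed Q n)) = emeasure B (\<Union>n. disjointed Q n)"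
      by (rule suminf_emeasure[OF _ disjoint_family_disjointed])
    moreover have "(\<Union>n. disjointed Q n) = (\<Union>i\<in>{i. x \<in> S i}. T i)"
      unfolding UN_disjointed_eq by (auto simp: Q_def split: if_splits)
    ultimately show ?thesis by simp
  qed
  have "rect_outer A B (\<Union>i. S i \<times> T i) = rect_outer A B (\<Union>n. disjointed (\<lambda>i. S i \<times> T i) n)"
    by (simp only: UN_disjointed_eq)
  also have "\<dots> \<le> (\<Sum>n. rect_outer A B (disjointed (\<lambda>i. S i \<times> T i) n))"
    by (rule rect_outer_countably_subadditive)
  also have "\<dots> \<le> (\<Sum>n. \<integral>\<^sup>+ x. g n x \<partial>A)"
    using g(2) by (intro suminf_le) (auto simp: disjointed_def atLeast0LessThan)
  also have "\<dots> = (\<integral>\<^sup>+ x. (\<Sum>n. g n x) \<partial>A)"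
    by (rule nn_integral_suminf[symmetric]) (rule g)
  finally show ?thesis unfolding sum .
qed

text \<open>
Finiteness gives a union \<open>U\<close> of rectangles covering \<open>E\<close> such that \<open>U - E\<close> has small measure, and
then a small cover of \<open>U - E\<close> by rectangles.  As the sections of \<open>E\<close> are null, the sections of \<open>U\<close> are,
up to null sets, contained in those of the second cover.  Hence \<open>U\<close>, and with it \<open>E\<close>, is small.
\<close>

lemma emeasure_prod_caratheodory_eq_0_if_null_sections:
  assumes E: "E \<in> sets (prod_caratheodory A B)"
    and fin: "emeasure (prod_caratheodory A B) E < \<infinity>"
    and sec: "AE x in A. AE y in B. (x, y) \<notin> E"
  shows "emeasure (prod_caratheodory A B) E = 0"
proof -
  let ?P = "prod_caratheodory A B"
  have *: "emeasure ?P E \<le> 0 + ennreal e" if e: "e > 0" for e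
  proof -
    have pos: "0 < ennreal (e / 2)" using e by simp
    have "rect_outer A B E < emeasure ?P E + ennreal (e / 2)"
      unfolding emeasure_prod_caratheodory[OF E, symmetric]
      using fin pos by (simp add: ennreal_add_left_cancel_less[of _ 0, simplified])
    then obtain S T where ST: "range S \<subseteq> sets A" "range T \<subseteq> sets B" "E \<subseteq> (\<Union>i::nat. S i \<times> T i)"
      "(\<Sum>i. emeasure A (S i) * emeasure B (T i)) < emeasure ?P E + ennreal (e / 2)"
      by (rule rect_outer_cover)
    have mST[measurable]: "S i \<in> sets A" "T i \<in> sets B" for i using ST by auto
    define U where "U = (\<Union>i. S i \<times> T i)"
    have U: "U \<in> sets ?P"
      unfolding U_def by (intro sets.countable_UN') (auto intro: times_in_sets_prod_caratheodory mST)
    have "emeasure ?P U \<le> (\<Sum>i. emeasure A (S i) * emeasure B (T i))"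
      unfolding emeasure_prod_caratheodory[OF U]
      by (rule rect_outer_le[OF ST(1,2)]) (simp add: U_def)
    then have Ule: "emeasure ?P U \<le> emeasure ?P E + ennreal (e / 2)" using ST(4) by simp
    have "emeasure ?P (U - E) = emeasure ?P U - emeasure ?P E"
      using E U ST(3) fin by (intro emeasure_Diff) (auto simp: U_def)
    also have "\<dots> \<le> ennreal (e / 2)"
      using Ule fin by (simp add: ennreal_minus_le_iff less_top[symmetric])
    also have "\<dots> < ennreal e" using e by (simp add: ennreal_lessI)
    finally have "rect_outer A B (U - E) < ennreal e"
      using E U by (simp add: emeasure_prod_caratheodory[symmetric] sets.Diff)
    then obtain V W where VW: "range V \<subseteq> sets A" "range W \<subseteq> sets B" "U - E \<subseteq> (\<Union>i::nat. V i \<times> W i)"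
      "(\<Sum>i. emeasure A (V i) * emeasure B (W i)) < ennreal e"
      by (rule rect_outer_cover)
    have mVW[measurable]: "V i \<in> sets A" "W i \<in> sets B" for i using VW by auto
    \<comment> \<open>\<open>U\<^sub>x\<close> is contained in the section of the second cover, up to the null set \<open>E\<^sub>x\<close>.\<close>
    have "AE x in A. emeasure B (\<Union>i\<in>{i. x \<in> S i}. T i) \<le> (\<Sum>i. indicator (V i) x * emeasure B (W i))"
      using sec
    proof eventually_elim
      case (elim x)
      have "emeasure B (\<Union>i\<in>{i. x \<in> S i}. T i) \<le> emeasure B (\<Union>i\<in>{i. x \<in> V i}. W i)"
      proof (rule emeasure_mono_AE)
        show "AE y in B. y \<in> (\<Union>i\<in>{i. x \<in> S i}. T i) \<longrightarrow> y \<in> (\<Union>i\<in>{i. x \<in> V i}. W i)"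
          using elim by eventually_elim (use VW(3) in \<open>auto simp: U_def\<close>)
      qed measurable
      also have "\<dots> \<le> (\<Sum>i. indicator (V i) x * emeasure B (W i))"
        by (rule emeasure_section_le[OF VW(2)])
      finally show ?case .
    qed
    then have "(\<integral>\<^sup>+ x. emeasure B (\<Union>i\<in>{i. x \<in> S i}. T i) \<partial>A) \<le>
        (\<integral>\<^sup>+ x. (\<Sum>i. indicator (V i) x * emeasure B (W i)) \<partial>A)"
      by (rule nn_integral_mono_AE)
    also have "\<dots> = (\<Sum>i. emeasure A (V i) * emeasure B (W i))"
      by (rule nn_integral_sections[OF VW(1,2)])
    finally have "rect_outer A B U \<le> ennreal e"
      using rect_outer_UN_le[of S A T B, OF mST] VW(4) unfolding U_def by simp
    moreover have "emeasure ?P E \<le> rect_outer A B U"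
      unfolding emeasure_prod_caratheodory[OF E] using ST(3) by (intro rect_outer_mono) (simp add: U_def)
    ultimately show ?thesis by simp
  qed
  have "emeasure ?P E \<le> 0" by (rule ennreal_le_epsilon) (rule *)
  then show ?thesis by simp
qed

text \<open>
The set where the maps differ may have infinite measure, but it is the union of the
superlevel sets of \<open>d (f z) (g z)\<^sup>p\<close>, which are of finite measure by Markov's inequality.
\<close>

lemma (in Metric_space) AE_prod_caratheodory_eqI:
  assumes f: "f \<in> separably_measurable (prod_caratheodory A B) M d"
    and g: "g \<in> separably_measurable (prod_caratheodory A B) M d"
    and fin: "pow_integral p (prod_caratheodory A B) d f g < \<infinity>"
    and sec: "AE x in A. AE y in B. f (x, y) = g (x, y)"
  shows "AE z in prod_caratheodory A B. f z = g z"
proof -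
  let ?P = "prod_caratheodory A B"
  define \<phi> where "\<phi> z = ennreal (d (f z) (g z) powr p)" for z
  have [measurable]: "(\<lambda>z. d (f z) (g z)) \<in> borel_measurable ?P"
    by (rule borel_measurable_mdist[OF f g])
  have [measurable]: "\<phi> \<in> borel_measurable ?P" unfolding \<phi>_def by measurable
  define E where "E n = {z \<in> space ?P. 1 \<le> of_nat n * \<phi> z}" for n
  have E: "E n \<in> sets ?P" for n unfolding E_def by measurable
  have "AE z in ?P. z \<notin> E n" for n
  proof (rule AE_not_in)
    have "emeasure ?P (E n) \<le> of_nat n * (\<integral>\<^sup>+ z. \<phi> z * indicator (space ?P) z \<partial>?P)"
      unfolding E_def by (rule nn_integral_Markov_inequality) auto
    also have "\<dots> \<le> of_nat n * (\<integral>\<^sup>+ z. \<phi> z \<partial>?P)"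
      by (intro mult_left_mono nn_integral_mono) (auto split: split_indicator)
    also have "\<dots> < \<infinity>"
      using fin by (simp add: \<phi>_def pow_integral_def ennreal_mult_less_top of_nat_less_top)
    finally have "emeasure ?P (E n) < \<infinity>" .
    moreover have "AE x in A. AE y in B. (x, y) \<notin> E n"
      using sec AE_space[of A]
    proof eventually_elim
      case (elim x)
      from elim(1) AE_space[of B] show ?case
      proof eventually_elim
        case (elim y)
        have "f (x, y) \<in> M"
          by (rule separably_measurable_space[OF f])
             (use elim \<open>x \<in> space A\<close> in \<open>simp add: space_prod_caratheodory\<close>)
        then show ?case using elim(1) by (simp add: E_def \<phi>_def)
      qed
    qed
    ultimately show "E n \<in> null_sets ?P"
      using emeasure_prod_caratheodory_eq_0_if_null_sections[OF E] E by (simp add: null_sets_def)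
  qed
  then have "AE z in ?P. \<forall>n. z \<notin> E n" by (simp add: AE_all_countable)
  then show ?thesis
    using AE_space
  proof eventually_elim
    case (elim z)
    have "d (f z) (g z) = 0"
    proof (rule ccontr)
      assume "d (f z) (g z) \<noteq> 0"
      then have pos: "d (f z) (g z) powr p > 0" by simp
      obtain n :: nat where "1 / d (f z) (g z) powr p < n" using reals_Archimedean2 by blast
      then have "1 \<le> real n * d (f z) (g z) powr p" using pos by (simp add: divide_less_eq)
      then have "1 \<le> of_nat n * \<phi> z"
        unfolding \<phi>_def by (simp add: ennreal_of_nat_eq_real_of_nat ennreal_mult[symmetric] del: ennreal_1 add: ennreal_1[symmetric])
      then show False using elim by (simp add: E_def)
    qed
    then show ?case
      using separably_measurable_space[OF f elim(2)] separably_measurable_space[OF g elim(2)] by simp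
  qed
qed

section \<open>Classes modulo equality almost everywhere\<close>

lemma ae_class_eq_iff: "ae_class Y f = ae_class Y g \<longleftrightarrow> (AE y in Y. f y = g y)"
proof
  assume "ae_class Y f = ae_class Y g"
  moreover have "f \<in> ae_class Y f" by (simp add: ae_class_def)
  ultimately show "AE y in Y. f y = g y" by (auto simp: ae_class_def)
next
  assume eq: "AE y in Y. f y = g y"
  have "(AE y in Y. u y = f y) \<longleftrightarrow> (AE y in Y. u y = g y)" for u
  proof
    assume "AE y in Y. u y = f y" then show "AE y in Y. u y = g y" using eq by eventually_elim simp
  next
    assume "AE y in Y. u y = g y" then show "AE y in Y. u y = f y" using eq by eventually_elim simp
  qed
  then show "ae_class Y f = ae_class Y g" by (simp add: ae_class_def)
qed

lemma AE_rep_ae_class: "AE y in Y. rep (ae_class Y f) y = f y"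
proof -
  have "f \<in> ae_class Y f" by (simp add: ae_class_def)
  then have "rep (ae_class Y f) \<in> ae_class Y f" unfolding rep_def by (metis someI)
  then show ?thesis by (simp add: ae_class_def)
qed

lemma ae_class_in_L0: "f \<in> separably_measurable Y Z d \<Longrightarrow> ae_class Y f \<in> L0 Y Z d"
  by (simp add: L0_def)

lemma pow_integral_cong_AE:
  assumes "AE y in Y. f y = f' y" "AE y in Y. g y = g' y"
  shows "pow_integral p Y d f g = pow_integral p Y d f' g'"
  unfolding pow_integral_def
  by (rule nn_integral_cong_AE) (use assms in eventually_elim, simp)

lemma pow_integral_rep:
  "pow_integral p Y d (rep (ae_class Y f)) (rep (ae_class Y g)) = pow_integral p Y d f g"
  by (rule pow_integral_cong_AE; rule AE_rep_ae_class)

lemma (in Metric_space) pow_integral_finite_triangle: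
  assumes p: "0 \<le> p" and sm: "f \<in> separably_measurable Y M d" "g \<in> separably_measurable Y M d"
      "k \<in> separably_measurable Y M d"
    and fin: "pow_integral p Y d f k < \<infinity>" "pow_integral p Y d g k < \<infinity>"
  shows "pow_integral p Y d f g < \<infinity>"
  unfolding pow_integral_def
proof (rule nn_integral_powr_add_finite[OF p borel_measurable_mdist[OF sm(1,3)] borel_measurable_mdist[OF sm(2,3)]])
  show "d (f y) (g y) \<le> d (f y) (k y) + d (g y) (k y)" if "y \<in> space Y" for y
    by (rule triangle'; rule separably_measurable_space[OF _ that]; rule sm)
qed (use fin in \<open>simp_all add: pow_integral_def\<close>)

section \<open>Absolutely continuous curves and geodesics\<close>

text \<open>
A continuous function that does not vanish at a point of \<open>[a, b]\<close> does not vanish on a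
nondegenerate interval, which has positive measure.
\<close>

lemma AE_continuous_zero:
  fixes \<phi> :: "real \<Rightarrow> real"
  assumes ab: "a < b" and cont: "continuous_on {a..b} \<phi>" and ae: "AE t in leb a b. \<phi> t = 0"
    and t0: "t0 \<in> {a..b}"
  shows "\<phi> t0 = 0"
proof (rule ccontr)
  assume nz: "\<phi> t0 \<noteq> 0"
  obtain \<delta> where \<delta>: "\<delta> > 0" "\<And>t. t \<in> {a..b} \<Longrightarrow> dist t t0 < \<delta> \<Longrightarrow> dist (\<phi> t) (\<phi> t0) < \<bar>\<phi> t0\<bar>"
    using cont t0 nz unfolding continuous_on_iff by (metis zero_less_abs_iff)
  define u where "u = max a (t0 - \<delta>)"
  define v where "v = min b (t0 + \<delta>)"
  have uv: "u < v" using ab t0 \<delta>(1) by (auto simp: u_def v_def)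
  have ne: "t \<in> {a..b} \<and> \<phi> t \<noteq> 0" if "t \<in> {u<..<v}" for t
  proof -
    have "t \<in> {a..b}" "\<bar>t - t0\<bar> < \<delta>" using that by (auto simp: u_def v_def)
    then show ?thesis using \<delta>(2)[of t] by (auto simp: dist_real_def)
  qed
  obtain Z where Z: "{t \<in> {a..b}. \<phi> t \<noteq> 0} \<subseteq> Z" "Z \<in> sets (leb a b)" "emeasure (leb a b) Z = 0"
    using ae by (auto elim!: AE_E)
  have "{u<..<v} \<in> sets (leb a b)"
    using ne by (auto simp: sets_restrict_space_iff)
  then have "emeasure (leb a b) {u<..<v} = ennreal (v - u)"
    using uv ne by (subst emeasure_restrict_space) (auto simp: sets_restrict_space_iff)
  moreover have "emeasure (leb a b) {u<..<v} \<le> emeasure (leb a b) Z"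
    by (rule emeasure_mono[OF _ Z(2)]) (use ne Z(1) in blast)
  ultimately show False using Z(3) uv by (simp add: ennreal_eq_0_iff)
qed

text \<open>
The function \<open>H\<close> is a primitive of the density \<open>m\<close>; it is continuous because \<open>\<bar>m\<bar> \<le> 1 + \<bar>m\<bar>\<^sup>p\<close> makes
\<open>m\<close> integrable on the bounded interval.
\<close>

lemma AC_modulus:
  assumes p: "1 \<le> p" and c: "c \<in> AC p a b X d"
  obtains H where "continuous_on {a..b} H"
    "\<forall>s\<in>{a..b}. \<forall>t\<in>{a..b}. s \<le> t \<longrightarrow> d (c s) (c t) \<le> H t - H s"
proof -
  obtain m :: "real \<Rightarrow> real" where m[measurable]: "m \<in> borel_measurable (leb a b)"
    and int: "integrable (leb a b) (\<lambda>r. \<bar>m r\<bar> powr p)"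
    and le: "\<forall>s\<in>{a..b}. \<forall>t\<in>{a..b}. s \<le> t \<longrightarrow> d (c s) (c t) \<le> (LINT r:{s..t}|lebesgue. m r)"
    using c unfolding AC_def by auto
  have "\<bar>m r\<bar> \<le> 1 + \<bar>m r\<bar> powr p" for r
  proof (cases "\<bar>m r\<bar> \<le> 1")
    case False
    then have "\<bar>m r\<bar> powr 1 \<le> \<bar>m r\<bar> powr p" using p by (intro powr_mono) auto
    then show ?thesis by simp
  qed (simp add: add_increasing2)
  then have "integrable (leb a b) m"
    using int by (intro Bochner_Integration.integrable_bound[of _ "\<lambda>r. 1 + \<bar>m r\<bar> powr p" m])
      (auto simp: intro!: AE_I2)
  then have S: "set_integrable lebesgue {a..b} m"
    unfolding set_integrable_def by (subst (asm) integrable_restrict_space) auto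
  then have I: "m integrable_on {a..b}" by (rule set_lebesgue_integral_eq_integral(1))
  show ?thesis
  proof (rule that[of "\<lambda>t. integral {a..t} m"])
    show "continuous_on {a..b} (\<lambda>t. integral {a..t} m)"
      by (rule indefinite_integral_continuous_1[OF I])
    show "\<forall>s\<in>{a..b}. \<forall>t\<in>{a..b}. s \<le> t \<longrightarrow> d (c s) (c t) \<le> integral {a..t} m - integral {a..s} m"
    proof (intro ballI impI)
      fix s t assume st: "s \<in> {a..b}" "t \<in> {a..b}" "s \<le> t"
      have "(LINT r:{s..t}|lebesgue. m r) = integral {s..t} m"
        by (rule set_lebesgue_integral_eq_integral(2), rule set_integrable_subset[OF S]) (use st in auto)
      moreover have "integral {a..s} m + integral {s..t} m = integral {a..t} m"
        by (rule Henstock_Kurzweil_Integration.integral_combine)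
           (use st integrable_subinterval_real[OF I] in auto)
      ultimately show "d (c s) (c t) \<le> integral {a..t} m - integral {a..s} m"
        using le st by force
    qed
  qed
qed

lemma (in Metric_space) mdist_diff_le:
  assumes "x \<in> M" "y \<in> M" "x' \<in> M" "y' \<in> M"
  shows "\<bar>d x y - d x' y'\<bar> \<le> d x x' + d y y'"
  using triangle[of x x' y] triangle[of x' y' y] triangle[of x' x y'] triangle[of x y y'] assms
  by (simp add: abs_le_iff commute[of y' y] commute[of x' x])

lemma (in Metric_space) continuous_on_mdist_AC:
  assumes p: "1 \<le> p" and c: "c \<in> AC p a b M d" "c' \<in> AC p a b M d"
  shows "continuous_on {a..b} (\<lambda>t. d (c t) (c' t))"
proof -
  obtain H where H: "continuous_on {a..b} H"
    "\<forall>s\<in>{a..b}. \<forall>t\<in>{a..b}. s \<le> t \<longrightarrow> d (c s) (c t) \<le> H t - H s"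
    by (rule AC_modulus[OF p c(1)])
  obtain H' where H': "continuous_on {a..b} H'"
    "\<forall>s\<in>{a..b}. \<forall>t\<in>{a..b}. s \<le> t \<longrightarrow> d (c' s) (c' t) \<le> H' t - H' s"
    by (rule AC_modulus[OF p c(2)])
  define G where "G t = H t + H' t" for t
  have G: "continuous_on {a..b} G" unfolding G_def using H H' by (intro continuous_on_add)
  have cM: "c t \<in> M" "c' t \<in> M" if "t \<in> {a..b}" for t
    using c that by (auto simp: AC_def)
  have le: "\<bar>d (c s) (c' s) - d (c t) (c' t)\<bar> \<le> \<bar>G s - G t\<bar>" if "s \<in> {a..b}" "t \<in> {a..b}" for s t
  proof (cases "s \<le> t")
    case True
    then show ?thesis
      using mdist_diff_le[OF cM(1)[OF that(1)] cM(2)[OF that(1)] cM(1)[OF that(2)] cM(2)[OF that(2)]]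
        H(2)[rule_format, OF that] H'(2)[rule_format, OF that] by (simp add: G_def)
  next
    case False
    then show ?thesis
      using mdist_diff_le[OF cM(1)[OF that(2)] cM(2)[OF that(2)] cM(1)[OF that(1)] cM(2)[OF that(1)]]
        H(2)[rule_format, OF that(2,1)] H'(2)[rule_format, OF that(2,1)] by (simp add: G_def)
  qed
  show ?thesis
    unfolding continuous_on_iff
  proof (intro ballI allI impI)
    fix t e assume "t \<in> {a..b}" "(e::real) > 0"
    then obtain \<delta> where \<delta>: "\<delta> > 0" "\<forall>s\<in>{a..b}. dist s t < \<delta> \<longrightarrow> dist (G s) (G t) < e"
      using G unfolding continuous_on_iff by blast
    show "\<exists>\<delta>>0. \<forall>s\<in>{a..b}. dist s t < \<delta> \<longrightarrow> dist (d (c s) (c' s)) (d (c t) (c' t)) < e"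
    proof (intro exI[of _ \<delta>] conjI ballI impI)
      fix s assume "s \<in> {a..b}" "dist s t < \<delta>"
      then show "dist (d (c s) (c' s)) (d (c t) (c' t)) < e"
        using \<delta>(2) le[of s t] \<open>t \<in> {a..b}\<close> by (force simp: dist_real_def)
    qed (rule \<delta>)
  qed
qed

text \<open>
Two continuous curves that agree almost everywhere agree everywhere; so \<open>q\<^sub>p\<close> is injective.
\<close>

lemma (in Metric_space) inj_on_ae_class_AC:
  assumes p: "1 \<le> p" and ab: "a < b"
  shows "inj_on (ae_class (leb a b)) (AC p a b M d)"
proof (rule inj_onI)
  fix c c' assume c: "c \<in> AC p a b M d" "c' \<in> AC p a b M d"
    and eq: "ae_class (leb a b) c = ae_class (leb a b) c'"
  have cE: "c \<in> {a..b} \<rightarrow>\<^sub>E M" "c' \<in> {a..b} \<rightarrow>\<^sub>E M" using c by (auto simp: AC_def)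
  have "AE t in leb a b. t \<in> space (leb a b)" by (rule AE_space)
  then have "AE t in leb a b. d (c t) (c' t) = 0"
    using eq[unfolded ae_class_eq_iff]
    by eventually_elim (use PiE_mem[OF cE(1)] PiE_mem[OF cE(2)] in auto)
  then have "d (c t) (c' t) = 0" if "t \<in> {a..b}" for t
    using AE_continuous_zero[OF ab continuous_on_mdist_AC[OF p c]] that by blast
  then show "c = c'"
    using zero[OF PiE_mem[OF cE(1)] PiE_mem[OF cE(2)]] by (intro PiE_ext[OF cE]) blast
qed

lemma geodesics_subset_AC:
  assumes "a < b"
  shows "geodesics a b X d \<subseteq> AC p a b X d"
proof
  fix c assume c: "c \<in> geodesics a b X d"
  define m where "m = (\<lambda>r::real. d (c a) (c b) / (b - a))"
  have "d (c s) (c t) \<le> (LINT r:{s..t}|lebesgue. m r)" if "s \<in> {a..b}" "t \<in> {a..b}" "s \<le> t" for s t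
  proof -
    have "(LINT r:{s..t}|lebesgue. m r) = (t - s) * (d (c a) (c b) / (b - a))"
      using that(3) unfolding m_def set_lebesgue_integral_def by simp
    moreover have "d (c s) (c t) = \<bar>(t - s) / (b - a)\<bar> * d (c a) (c b)"
      using c that unfolding geodesics_def by blast
    ultimately show ?thesis using that(3) assms by simp
  qed
  moreover have "integrable (leb a b) (\<lambda>r. \<bar>m r\<bar> powr p)"
    unfolding m_def by (rule finite_measure.integrable_const[OF finite_measure_lebesgue_on]) simp
  moreover have "m \<in> borel_measurable (leb a b)" unfolding m_def by simp
  moreover have "c \<in> {a..b} \<rightarrow>\<^sub>E X" using c by (simp add: geodesics_def)
  ultimately show "c \<in> AC p a b X d"
    unfolding AC_def by (intro CollectI conjI exI[of _ m] ballI impI)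
qed

lemma geodesics_dist:
  "c \<in> geodesics a b X d \<Longrightarrow> s \<in> {a..b} \<Longrightarrow> t \<in> {a..b} \<Longrightarrow>
    d (c s) (c t) = \<bar>t - s\<bar> / \<bar>b - a\<bar> * d (c a) (c b)"
  unfolding geodesics_def abs_divide[symmetric] by blast

lemma geodesics_mem: "c \<in> geodesics a b X d \<Longrightarrow> t \<in> {a..b} \<Longrightarrow> c t \<in> X"
  by (auto simp: geodesics_def)

lemma (in Metric_space) geodesics_constant_speed:
  assumes ab: "a < b" and c: "c \<in> geodesics a b M d" and st: "s \<in> {a..b}" "t \<in> {a..b}"
  shows "d (c s) (c t) = d (c a) (c b) / (b - a) * \<bar>s - t\<bar>"
  using geodesics_dist[OF c st] ab by (simp add: abs_minus_commute)

lemma pow_integral_curves_le: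
  assumes p: "0 \<le> p" and ab: "a \<le> b" and le: "\<And>t. t \<in> {a..b} \<Longrightarrow> d (f t) (g t) \<le> C"
    and nonneg: "\<And>t. 0 \<le> d (f t) (g t)"
  shows "pow_integral p (leb a b) d f g \<le> ennreal (C powr p * (b - a))"
proof -
  have "pow_integral p (leb a b) d f g \<le> (\<integral>\<^sup>+ t. ennreal (C powr p) \<partial>leb a b)"
    unfolding pow_integral_def
    by (rule nn_integral_mono) (use le p nonneg in \<open>auto intro!: ennreal_leI powr_mono2\<close>)
  also have "\<dots> = ennreal (C powr p * (b - a))"
    using ab by (simp add: emeasure_restrict_space ennreal_mult)
  finally show ?thesis .
qed

lemma fun_dist_curves_le:
  assumes p: "0 < p" and ab: "a \<le> b" and le: "\<And>t. t \<in> {a..b} \<Longrightarrow> d (f t) (g t) \<le> C"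
    and nonneg: "\<And>t. 0 \<le> d (f t) (g t)"
  shows "fun_dist p (leb a b) d f g \<le> C * (b - a) powr (1 / p)"
proof -
  have C: "0 \<le> C" using le[of a] nonneg[of a] ab by auto
  have "enn2real (pow_integral p (leb a b) d f g) \<le> C powr p * (b - a)"
    using pow_integral_curves_le[of p a b d f g C] assms by (intro enn2real_leI) auto
  then have "fun_dist p (leb a b) d f g \<le> (C powr p * (b - a)) powr (1 / p)"
    unfolding fun_dist_def using p by (intro powr_mono2) auto
  also have "\<dots> = C * (b - a) powr (1 / p)"
    using p C ab by (simp add: powr_mult powr_powr)
  finally show ?thesis .
qed

text \<open>
The distance is \<open>d\<^sub>p\<close>.  It is finite because the distance of two geodesics is bounded, and it
separates points because geodesics are continuous.
\<close>

lemma (in Metric_space) Metric_space_geodesics: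
  assumes p: "1 < p" and ab: "a < b"
  shows "Metric_space (geodesics a b M d) (fun_dist p (leb a b) d)"
proof -
  let ?G = "geodesics a b M d" and ?D = "fun_dist p (leb a b) d"
  have AC: "c \<in> AC p a b M d" if "c \<in> ?G" for c using geodesics_subset_AC[OF ab] that by blast
  have cont: "continuous_on {a..b} (\<lambda>t. d (c t) (c' t))" if "c \<in> ?G" "c' \<in> ?G" for c c'
    using p by (intro continuous_on_mdist_AC[of p] AC that) simp
  have meas: "(\<lambda>t. d (c t) (c' t)) \<in> borel_measurable (leb a b)" if "c \<in> ?G" "c' \<in> ?G" for c c'
    by (rule continuous_imp_measurable_on_sets_lebesgue[OF cont[OF that]]) simp
  have fin: "pow_integral p (leb a b) d c c' < \<infinity>" if c: "c \<in> ?G" "c' \<in> ?G" for c c'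
  proof -
    obtain C where C: "\<forall>t\<in>{a..b}. d (c t) (c' t) \<le> C"
      using continuous_attains_sup[OF compact_Icc _ cont[OF c]] ab by fastforce
    then have "pow_integral p (leb a b) d c c' \<le> ennreal (C powr p * (b - a))"
      using p ab by (intro pow_integral_curves_le) auto
    then show ?thesis by (simp add: order_le_less_trans)
  qed
  show ?thesis
  proof
    show "0 \<le> ?D c c'" for c c' by (simp add: fun_dist_def)
    show "?D c c' = ?D c' c" for c c' by (simp add: fun_dist_def pow_integral_def commute)
    show "?D c c' = 0 \<longleftrightarrow> c = c'" if c: "c \<in> ?G" "c' \<in> ?G" for c c'
    proof
      assume "?D c c' = 0"
      then have "pow_integral p (leb a b) d c c' = 0"
        using fin[OF c] by (auto simp: fun_dist_def enn2real_eq_0_iff)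
      then have "AE t in leb a b. d (c t) (c' t) = 0"
        unfolding pow_integral_def using meas[OF c] by (subst (asm) nn_integral_0_iff_AE) auto
      then have "ae_class (leb a b) c = ae_class (leb a b) c'"
        unfolding ae_class_eq_iff using AE_space[of "leb a b"]
        by eventually_elim (use geodesics_mem[OF c(1)] geodesics_mem[OF c(2)] in auto)
      then show "c = c'"
        using inj_on_ae_class_AC[of p a b] p ab AC c by (auto dest: inj_onD)
    next
      assume "c = c'"
      then have "pow_integral p (leb a b) d c c' = (\<integral>\<^sup>+ t. 0 \<partial>leb a b)"
        unfolding pow_integral_def using geodesics_mem[OF c(1)] by (intro nn_integral_cong) simp
      then show "?D c c' = 0" by (simp add: fun_dist_def)
    qed
    show "?D c c'' \<le> ?D c c' + ?D c' c''" if c: "c \<in> ?G" "c' \<in> ?G" "c'' \<in> ?G" for c c' c''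
      unfolding fun_dist_def pow_integral_def
    proof (rule Minkowski_nn_integral[OF p meas[OF c(1,2)] meas[OF c(2,3)]])
      show "d (c t) (c'' t) \<le> d (c t) (c' t) + d (c' t) (c'' t)" if "t \<in> space (leb a b)" for t
        using that geodesics_mem[OF c(1)] geodesics_mem[OF c(2)] geodesics_mem[OF c(3)]
        by (intro triangle) auto
    qed (use fin[OF c(1,2)] fin[OF c(2,3)] in \<open>auto simp: pow_integral_def\<close>)
  qed
qed

section \<open>Measurable families of geodesics\<close>

text \<open>
The points dividing \<open>[a, b]\<close> into \<open>n + 1\<close> equal parts; truncation at \<open>Suc n\<close> makes \<open>grid a b n k\<close> a
point of \<open>[a, b]\<close> for every \<open>k\<close>, so that it can serve in families indexed by all of \<open>nat\<close>.
\<close>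

definition grid :: "real \<Rightarrow> real \<Rightarrow> nat \<Rightarrow> nat \<Rightarrow> real" where
  "grid a b n k = a + (b - a) * (real (min k (Suc n)) / real (Suc n))"

text \<open>
The index of the last grid point that is not to the right of \<open>t\<close>.
\<close>

definition grid_index :: "real \<Rightarrow> real \<Rightarrow> nat \<Rightarrow> real \<Rightarrow> nat" where
  "grid_index a b n t = nat \<lfloor>(t - a) / (b - a) * real (Suc n)\<rfloor>"

lemma grid_mem:
  assumes "a \<le> b" shows "grid a b n k \<in> {a..b}"
proof -
  have "real (min k (Suc n)) / real (Suc n) \<le> 1" by simp
  then have "(b - a) * (real (min k (Suc n)) / real (Suc n)) \<le> (b - a) * 1"
    using assms by (intro mult_left_mono) auto
  moreover have "0 \<le> (b - a) * (real (min k (Suc n)) / real (Suc n))" using assms by simp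
  ultimately show ?thesis unfolding grid_def by auto
qed

lemma grid_index_le:
  assumes "a < b" "t \<in> {a..b}" shows "grid_index a b n t \<le> Suc n"
proof -
  have "(t - a) / (b - a) \<le> 1" using assms by simp
  then have "(t - a) / (b - a) * real (Suc n) \<le> 1 * real (Suc n)"
    by (rule mult_right_mono) simp
  then have "\<lfloor>(t - a) / (b - a) * real (Suc n)\<rfloor> \<le> \<lfloor>real (Suc n)\<rfloor>"
    by (intro floor_mono) simp
  then show ?thesis unfolding grid_index_def floor_of_nat nat_le_iff .
qed

lemma grid_approx:
  assumes ab: "a < b" and t: "t \<in> {a..b}"
  shows "\<bar>grid a b n (grid_index a b n t) - t\<bar> \<le> (b - a) / Suc n"
proof -
  define r where "r = (t - a) / (b - a) * real (Suc n)"
  have r: "0 \<le> r" using ab t by (simp add: r_def)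
  define k where "k = grid_index a b n t"
  have k: "real k \<le> r" "r \<le> real k + 1"
    using r floor_correct[of r] unfolding k_def grid_index_def r_def[symmetric] by simp_all
  have "min k (Suc n) = k" using grid_index_le[OF assms] by (simp add: k_def)
  then have g: "grid a b n k = a + (b - a) * (real k / Suc n)" by (simp add: grid_def)
  have "t = a + (b - a) * (r / Suc n)" using ab by (simp add: r_def)
  then have "t - grid a b n k = (b - a) * (r / Suc n) - (b - a) * (real k / Suc n)"
    using g by linarith
  also have "\<dots> = (b - a) / Suc n * (r - real k)" by (simp add: algebra_simps add_divide_distrib diff_divide_distrib)
  finally have "t - grid a b n k = (b - a) / Suc n * (r - real k)" .
  moreover have "0 \<le> (b - a) / Suc n * (r - real k)" using k ab by simp
  moreover have "(b - a) / Suc n * (r - real k) \<le> (b - a) / Suc n * 1"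
    using k ab by (intro mult_left_mono) auto
  ultimately show ?thesis unfolding k_def by linarith
qed

lemma grid_tendsto:
  assumes ab: "a < b" and t: "t \<in> {a..b}"
  shows "(\<lambda>n. grid a b n (grid_index a b n t)) \<longlonglongrightarrow> t"
proof -
  have "(\<lambda>n. (b - a) * (1 / real (Suc n))) \<longlonglongrightarrow> (b - a) * 0"
    by (intro tendsto_mult tendsto_const LIMSEQ_Suc[OF lim_1_over_n])
  then have "(\<lambda>n. (b - a) / Suc n) \<longlonglongrightarrow> 0" by simp
  then have "(\<lambda>n. grid a b n (grid_index a b n t) - t) \<longlonglongrightarrow> 0"
    by (rule Lim_null_comparison[rotated])
       (simp add: grid_approx[OF assms] del: of_nat_Suc)
  then show ?thesis by (simp add: LIM_zero_iff)
qed

lemma measurable_grid_index [measurable]: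
  "grid_index a b n \<in> borel \<rightarrow>\<^sub>M count_space UNIV"
  unfolding grid_index_def by measurable

lemma (in Metric_space) tendsto_mdist:
  assumes "\<And>n. f n \<in> M" "\<And>n. g n \<in> M" "y \<in> M" "z \<in> M"
    and f: "(\<lambda>n. d (f n) y) \<longlonglongrightarrow> 0" and g: "(\<lambda>n. d (g n) z) \<longlonglongrightarrow> 0"
  shows "(\<lambda>n. d (f n) (g n)) \<longlonglongrightarrow> d y z"
proof -
  have "(\<lambda>n. d (f n) y + d (g n) z) \<longlonglongrightarrow> 0"
    using tendsto_add[OF f g] by simp
  then have "(\<lambda>n. d (f n) (g n) - d y z) \<longlonglongrightarrow> 0"
    by (rule Lim_null_comparison[rotated]) (simp add: mdist_diff_le assms)
  then show ?thesis by (simp add: LIM_zero_iff)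
qed

text \<open>
A map that is measurable in one variable and Lipschitz in the other is jointly measurable: it is
the limit of the maps obtained by rounding the time to a grid.  The time is a function \<open>u\<close> on \<open>Y\<close> so
that the result applies to any measure on a product.
\<close>

lemma (in Metric_space) separably_measurable_curve_compose:
  assumes ab: "a < b"
    and meas: "\<And>t. t \<in> {a..b} \<Longrightarrow> (\<lambda>y. \<kappa> y t) \<in> separably_measurable Y M d"
    and lip: "\<And>y s t. y \<in> space Y \<Longrightarrow> s \<in> {a..b} \<Longrightarrow> t \<in> {a..b} \<Longrightarrow> d (\<kappa> y s) (\<kappa> y t) \<le> L y * \<bar>s - t\<bar>"
    and u[measurable]: "u \<in> borel_measurable Y" and uI: "\<And>y. y \<in> space Y \<Longrightarrow> u y \<in> {a..b}"
  shows "(\<lambda>y. \<kappa> y (u y)) \<in> separably_measurable Y M d"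
proof (rule separably_measurable_lim)
  define q where "q n t = grid a b n (grid_index a b n t)" for n t
  have grid: "grid a b n k \<in> {a..b}" for n k using ab by (intro grid_mem) simp
  show "(\<lambda>y. \<kappa> y (q n (u y))) \<in> separably_measurable Y M d" for n
    unfolding q_def
    by (rule separably_measurable_countable_compose[where f="\<lambda>k y. \<kappa> y (grid a b n k)"])
       (use meas grid in auto)
  show "(\<lambda>y. \<kappa> y (u y)) \<in> space Y \<rightarrow> M"
    using separably_measurable_space[OF meas[OF uI]] by blast
  show "(\<lambda>n. d (\<kappa> y (q n (u y))) (\<kappa> y (u y))) \<longlonglongrightarrow> 0" if y: "y \<in> space Y" for y
  proof -
    have "(\<lambda>n. q n (u y)) \<longlonglongrightarrow> u y" unfolding q_def by (rule grid_tendsto[OF ab uI[OF y]])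
    then have "(\<lambda>n. \<bar>q n (u y) - u y\<bar>) \<longlonglongrightarrow> 0"
      by (simp add: tendsto_rabs_zero_iff LIM_zero_iff)
    then have "(\<lambda>n. L y * \<bar>q n (u y) - u y\<bar>) \<longlonglongrightarrow> 0"
      by (rule tendsto_mult_right_zero)
    then show ?thesis
      by (rule Lim_null_comparison[rotated]) (simp add: lip[OF y _ uI[OF y]] q_def grid del: atLeastAtMost_iff)
  qed
qed

text \<open>
The distance of \<open>\<gamma> x\<close> to a fixed geodesic is an integral over \<open>[a, b]\<close>, measurable in \<open>x\<close> by joint
measurability.  For separability, geodesics are classified by the index \<open>(n, K, zs)\<close> of a grid, a
bound on the length and a list of approximate values on the grid, taken from a countable set.
Geodesics with the same index are close, and there are countably many indices; one geodesic is
picked for each index that occurs.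
\<close>

lemma (in Metric_space) separably_measurable_geodesics:
  assumes p: "1 < p" and ab: "a < b"
    and geo: "\<And>x. x \<in> space Y \<Longrightarrow> \<gamma> x \<in> geodesics a b M d"
    and meas: "\<And>t. t \<in> {a..b} \<Longrightarrow> (\<lambda>x. \<gamma> x t) \<in> separably_measurable Y M d"
  shows "\<gamma> \<in> separably_measurable Y (geodesics a b M d) (fun_dist p (leb a b) d)"
proof -
  let ?G = "geodesics a b M d" and ?D = "fun_dist p (leb a b) d"
  interpret G: Metric_space ?G ?D by (rule Metric_space_geodesics[OF p ab])
  interpret leb: finite_measure "leb a b" by (rule finite_measure_lebesgue_on) simp
  have grid: "grid a b n k \<in> {a..b}" for n k using ab by (intro grid_mem) simp
  have meas_D: "(\<lambda>x. ?D \<eta> (\<gamma> x)) \<in> borel_measurable Y" if \<eta>: "\<eta> \<in> ?G" for \<eta>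
  proof -
    let ?Z = "Y \<Otimes>\<^sub>M leb a b"
    have sp: "snd z \<in> {a..b}" "fst z \<in> space Y" if "z \<in> space ?Z" for z
      using that by (auto simp: space_pair_measure)
    have [measurable]: "snd \<in> borel_measurable ?Z"
    proof -
      have "(\<lambda>t. t) \<in> borel_measurable (leb a b)"
        by (intro measurable_restrict_space1 measurable_completion) simp
      then show ?thesis by (rule measurable_compose[OF measurable_snd])
    qed
    have eval: "(\<lambda>z. \<gamma> (fst z) t) \<in> separably_measurable ?Z M d" if "t \<in> {a..b}" for t
      by (rule separably_measurable_compose[OF meas[OF that] measurable_fst])
    have 1: "(\<lambda>z. \<gamma> (fst z) (snd z)) \<in> separably_measurable ?Z M d"
    proof (rule separably_measurable_curve_compose[OF ab, where \<kappa>="\<lambda>z. \<gamma> (fst z)"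
          and L="\<lambda>z. d (\<gamma> (fst z) a) (\<gamma> (fst z) b) / (b - a)"])
      show "d (\<gamma> (fst z) s) (\<gamma> (fst z) t) \<le>
          d (\<gamma> (fst z) a) (\<gamma> (fst z) b) / (b - a) * \<bar>s - t\<bar>"
        if "z \<in> space ?Z" "s \<in> {a..b}" "t \<in> {a..b}" for z s t
        using geodesics_constant_speed[OF ab geo[OF sp(2)[OF that(1)]] that(2,3)] by simp
    qed (use eval sp(1) in \<open>simp_all del: atLeastAtMost_iff\<close>)
    have 2: "(\<lambda>z. \<eta> (snd z)) \<in> separably_measurable ?Z M d"
    proof (rule separably_measurable_curve_compose[OF ab, where \<kappa>="\<lambda>z. \<eta>"
          and L="\<lambda>z. d (\<eta> a) (\<eta> b) / (b - a)"])
      show "d (\<eta> s) (\<eta> t) \<le> d (\<eta> a) (\<eta> b) / (b - a) * \<bar>s - t\<bar>"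
        if "s \<in> {a..b}" "t \<in> {a..b}" for s t
        using geodesics_constant_speed[OF ab \<eta> that] by simp
      show "(\<lambda>z. \<eta> t) \<in> separably_measurable ?Z M d" if "t \<in> {a..b}" for t
        by (rule separably_measurable_const[OF geodesics_mem[OF \<eta> that]])
    qed (use sp(1) in \<open>simp_all del: atLeastAtMost_iff\<close>)
    have [measurable]: "(\<lambda>z. d (\<eta> (snd z)) (\<gamma> (fst z) (snd z))) \<in> borel_measurable ?Z"
      by (rule borel_measurable_mdist[OF 2 1])
    show ?thesis
      unfolding fun_dist_def pow_integral_def by measurable
  qed
  have "\<exists>E. countable E \<and> E \<subseteq> M \<and> (\<forall>x\<in>space Y. \<forall>e>0. \<exists>z\<in>E. d z (\<gamma> x (grid a b n k)) < e)" for n k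
    using meas[OF grid, of n k] unfolding separably_measurable_iff by simp
  then obtain E where E: "\<And>n k. countable (E n k)" "\<And>n k. E n k \<subseteq> M"
    "\<And>n k. \<forall>x\<in>space Y. \<forall>e>0. \<exists>z\<in>E n k. d z (\<gamma> x (grid a b n k)) < e"
    by metis
  define Z where "Z = (\<Union>n k. E n k)"
  have Z: "countable Z" unfolding Z_def using E(1) by simp
  have ZM: "Z \<subseteq> M" unfolding Z_def using E(2) by blast
  define R where "R i \<eta> \<longleftrightarrow> (case i of (n::nat, K::nat, zs) \<Rightarrow> \<eta> \<in> ?G \<and> d (\<eta> a) (\<eta> b) \<le> K \<and>
     (\<forall>k\<le>Suc n. d (zs ! k) (\<eta> (grid a b n k)) < 1 / Suc n))" for i \<eta>
  define D where "D = (\<lambda>i. SOME \<eta>. R i \<eta>) ` {i \<in> UNIV \<times> UNIV \<times> lists Z. \<exists>\<eta>. R i \<eta>}"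
  have RS: "R i (SOME \<eta>. R i \<eta>)" if "\<exists>\<eta>. R i \<eta>" for i by (rule someI_ex[OF that])
  have "countable (UNIV \<times> UNIV \<times> lists Z :: (nat \<times> nat \<times> 'a list) set)"
    by (intro countable_SIGMA countable_lists Z countableI_type)
  then have "countable D"
    unfolding D_def by (rule countable_image[OF countable_subset, rotated]) simp
  moreover have "D \<subseteq> ?G"
  proof
    fix \<eta> assume "\<eta> \<in> D"
    then obtain i where "R i \<eta>" using RS unfolding D_def by blast
    then show "\<eta> \<in> ?G" unfolding R_def by (cases i) simp
  qed
  moreover have "\<exists>\<eta>\<in>D. ?D \<eta> (\<gamma> x) < e" if x: "x \<in> space Y" and e: "e > 0" for x e
  proof -
    note \<gamma> = geo[OF x]
    obtain K :: nat where K: "d (\<gamma> x a) (\<gamma> x b) \<le> K" using real_arch_simple by blast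
    define B where "B = (b - a) powr (1 / p)"
    have B: "B > 0" using ab by (simp add: B_def)
    \<comment> \<open>\<open>(2 + 2 * K) / Suc n\<close> will bound the pointwise distance, and \<open>B\<close> converts it to \<open>d\<^sub>p\<close>.\<close>
    have "e / ((2 + 2 * K) * B) > 0" using B e by simp
    then obtain n :: nat where n: "1 / Suc n < e / ((2 + 2 * K) * B)" by (rule nat_approx_posE)
    have "\<exists>z\<in>Z. d z (\<gamma> x (grid a b n k)) < 1 / Suc n" for k
      using E(3)[of n k, rule_format, OF x, of "1 / Suc n"] by (auto simp: Z_def)
    then obtain z where z: "\<And>k. z k \<in> Z" "\<And>k. d (z k) (\<gamma> x (grid a b n k)) < 1 / Suc n"
      by metis
    define zs where "zs = map z [0..<Suc (Suc n)]"
    have zs_nth: "zs ! k = z k" if "k \<le> Suc n" for k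
      using that unfolding zs_def by (simp only: nth_map_upt) simp
    have "zs \<in> lists Z" using z(1) by (auto simp: zs_def)
    define i where "i = (n, K, zs)"
    \<comment> \<open>So \<open>i\<close> is an index that occurs, and a geodesic has been picked for it.\<close>
    have "R i (\<gamma> x)" using \<gamma> K z(2) zs_nth unfolding R_def i_def by simp
    define \<eta> where "\<eta> = (SOME \<eta>. R i \<eta>)"
    have "R i \<eta>" using RS \<open>R i (\<gamma> x)\<close> unfolding \<eta>_def by blast
    then have \<eta>: "\<eta> \<in> ?G" "d (\<eta> a) (\<eta> b) \<le> K"
      "\<And>k. k \<le> Suc n \<Longrightarrow> d (z k) (\<eta> (grid a b n k)) < 1 / Suc n"
      using zs_nth unfolding R_def i_def by auto
    have "\<eta> \<in> D" unfolding D_def \<eta>_def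
      using \<open>R i (\<gamma> x)\<close> \<open>zs \<in> lists Z\<close> by (intro imageI) (auto simp: i_def)
    \<comment> \<open>Between grid points each curve moves by at most \<open>K / Suc n\<close>, and both are within \<open>1 / Suc n\<close> of \<open>z k\<close> at the grid point.\<close>
    have "d (\<eta> t) (\<gamma> x t) \<le> (2 + 2 * K) / Suc n" if t: "t \<in> {a..b}" for t
    proof -
      define k where "k = grid_index a b n t"
      define s where "s = grid a b n k"
      have k: "k \<le> Suc n" unfolding k_def by (rule grid_index_le[OF ab t])
      have s: "s \<in> {a..b}" "\<bar>s - t\<bar> \<le> (b - a) / Suc n"
        using grid grid_approx[OF ab t] by (simp_all add: s_def k_def del: atLeastAtMost_iff)
      have move: "d (c t) (c s) \<le> K / Suc n" if "c \<in> ?G" "d (c a) (c b) \<le> K" for c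
      proof -
        have "d (c t) (c s) = d (c a) (c b) / (b - a) * \<bar>s - t\<bar>"
          using geodesics_constant_speed[OF ab that(1) t s(1)] by (simp add: abs_minus_commute)
        also have "\<dots> \<le> K / (b - a) * ((b - a) / Suc n)"
          using that(2) s(2) ab by (intro mult_mono divide_right_mono) auto
        finally show ?thesis using ab by simp
      qed
      have mem: "\<eta> t \<in> M" "\<eta> s \<in> M" "\<gamma> x t \<in> M" "\<gamma> x s \<in> M" "z k \<in> M"
        using geodesics_mem[OF \<eta>(1)] geodesics_mem[OF \<gamma>] s(1) t z(1) ZM by auto
      have "d (\<eta> t) (\<gamma> x t) \<le> d (\<eta> t) (\<eta> s) + d (\<eta> s) (z k) + d (z k) (\<gamma> x s) + d (\<gamma> x s) (\<gamma> x t)"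
        using triangle[of "\<eta> t" "\<eta> s" "\<gamma> x t"] triangle[of "\<eta> s" "z k" "\<gamma> x t"]
          triangle[of "z k" "\<gamma> x s" "\<gamma> x t"] mem by linarith
      also have "\<dots> \<le> K / Suc n + 1 / Suc n + 1 / Suc n + K / Suc n"
        using move[OF \<eta>(1,2)] move[OF \<gamma> K] \<eta>(3)[OF k] z(2)[of k]
        by (intro add_mono) (auto simp: s_def commute[of "\<eta> (grid a b n k)" "z k"]
              commute[of "\<gamma> x (grid a b n k)" "\<gamma> x t"])
      also have "\<dots> = (2 + 2 * K) / Suc n" by (simp add: add_divide_distrib)
      finally show ?thesis .
    qed
    then have "?D \<eta> (\<gamma> x) \<le> (2 + 2 * K) / Suc n * B"
      unfolding B_def using p ab by (intro fun_dist_curves_le) auto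
    also have "\<dots> = 1 / Suc n * ((2 + 2 * K) * B)" by simp
    also have "\<dots> < e" using n B by (simp add: pos_less_divide_eq add_pos_nonneg del: of_nat_Suc)
    finally show ?thesis using \<open>\<eta> \<in> D\<close> by blast
  qed
  ultimately show ?thesis
    using geo meas_D by (intro G.separably_measurableI[where D=D])
qed

section \<open>Geodesics of maps are maps of geodesics\<close>

text \<open>
For \<open>r < q < w\<close> the \<open>p\<close>-th powers of the three norms are \<open>((q - r) / (b - a))\<^sup>p K\<close> and so on, where \<open>K\<close>
belongs to the endpoints; hence the case of equality in Minkowski's inequality applies, with
\<open>l = (q - r) / (w - r)\<close>.  The triple \<open>a, r, b\<close> compares the distance from the starting point with the
total distance, and the triple \<open>a, r, q\<close> then gives all other distances.
\<close>

lemma (in Metric_space) Lp_geodesic_pointwise: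
  assumes p: "1 < p" and ab: "a < b"
    and c: "c \<in> geodesics a b (Lp p Y M d H) (Lp_dist p Y d)"
    and H: "H \<in> L0 Y M d"
    and g: "\<And>t. t \<in> {a..b} \<Longrightarrow> g t \<in> separably_measurable Y M d"
    and cg: "\<And>t. t \<in> {a..b} \<Longrightarrow> c t = ae_class Y (g t)"
    and s: "s \<in> {a..b}" and t: "t \<in> {a..b}"
  shows "AE x in Y. d (g s x) (g t x) = \<bar>s - t\<bar> / (b - a) * d (g a x) (g b x)"
proof -
  obtain k where k: "k \<in> separably_measurable Y M d" "H = ae_class Y k"
    using H by (auto simp: L0_def)
  have abI: "a \<in> {a..b}" "b \<in> {a..b}" using ab by auto
  have fin_k: "pow_integral p Y d (g r) k < \<infinity>" if "r \<in> {a..b}" for r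
    using geodesics_mem[OF c that] by (simp add: Lp_def cg[OF that] k(2) pow_integral_rep)
  have fin: "pow_integral p Y d (g r) (g q) < \<infinity>" if "r \<in> {a..b}" "q \<in> {a..b}" for r q
    by (rule pow_integral_finite_triangle[OF _ g[OF that(1)] g[OF that(2)] k(1) fin_k[OF that(1)] fin_k[OF that(2)]])
       (use p in simp)
  have gM: "g r x \<in> M" if "r \<in> {a..b}" "x \<in> space Y" for r x
    by (rule separably_measurable_space[OF g[OF that(1)] that(2)])
  define K where "K = enn2real (pow_integral p Y d (g a) (g b))"
  have K: "0 \<le> K" by (simp add: K_def)
  have int: "pow_integral p Y d (g r) (g q) = ennreal (((q - r) / (b - a)) powr p * K)"
    if "r \<in> {a..b}" "q \<in> {a..b}" "r \<le> q" for r q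
  proof -
    let ?I = "enn2real (pow_integral p Y d (g r) (g q))"
    have "Lp_dist p Y d (c r) (c q) = \<bar>(q - r) / (b - a)\<bar> * Lp_dist p Y d (c a) (c b)"
      using c that unfolding geodesics_def by blast
    then have "?I powr (1 / p) = (q - r) / (b - a) * K powr (1 / p)"
      using that(3) ab
      by (simp add: Lp_dist_def fun_dist_def cg that(1,2) abI pow_integral_rep K_def
          del: atLeastAtMost_iff)
    then have "(?I powr (1 / p)) powr p = ((q - r) / (b - a) * K powr (1 / p)) powr p"
      by (rule arg_cong)
    also have "\<dots> = ((q - r) / (b - a)) powr p * (K powr (1 / p)) powr p"
      by (rule powr_mult)
    finally have "?I = ((q - r) / (b - a)) powr p * K" using p K by (simp add: powr_powr)
    then show ?thesis using fin[OF that(1,2)] by (metis ennreal_enn2real infinity_ennreal_def)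
  qed
  have three: "AE x in Y. d (g r x) (g q x) = (q - r) / (w - r) * d (g r x) (g w x) \<and>
      d (g q x) (g w x) = (1 - (q - r) / (w - r)) * d (g r x) (g w x)"
    if I: "r \<in> {a..b}" "q \<in> {a..b}" "w \<in> {a..b}" and lt: "r < q" "q < w" for r q w
  proof (rule Minkowski_equality_AE[OF p, where K="((w - r) / (b - a)) powr p * K"])
    show "0 < (q - r) / (w - r)" "(q - r) / (w - r) < 1" using lt by auto
    show "(\<lambda>x. d (g r x) (g q x)) \<in> borel_measurable Y" "(\<lambda>x. d (g q x) (g w x)) \<in> borel_measurable Y"
      "(\<lambda>x. d (g r x) (g w x)) \<in> borel_measurable Y"
      by (rule borel_measurable_mdist; rule g; fact)+
    show "d (g r x) (g w x) \<le> d (g r x) (g q x) + d (g q x) (g w x)" if "x \<in> space Y" for x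
      using gM[OF I(1) that] gM[OF I(2) that] gM[OF I(3) that] by (rule triangle)
    have prod: "u powr p * (v powr p * K) = (u * v) powr p * K" if "0 \<le> u" "0 \<le> v" for u v
      using that by (simp add: powr_mult)
    have nn: "0 \<le> (q - r) / (w - r)" "0 \<le> 1 - (q - r) / (w - r)" "0 \<le> (w - r) / (b - a)"
      using lt ab by auto
    have 1: "(q - r) / (w - r) * ((w - r) / (b - a)) = (q - r) / (b - a)"
      using lt ab by simp
    have "1 - (q - r) / (w - r) = (w - q) / (w - r)" using lt by (simp add: field_simps)
    then have 2: "(1 - (q - r) / (w - r)) * ((w - r) / (b - a)) = (w - q) / (b - a)"
      using lt ab by simp
    show "(\<integral>\<^sup>+ x. ennreal (d (g r x) (g q x) powr p) \<partial>Y) =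
        ennreal (((q - r) / (w - r)) powr p * (((w - r) / (b - a)) powr p * K))"
      unfolding prod[OF nn(1,3)] 1 using int[OF I(1,2)] lt by (simp add: pow_integral_def)
    show "(\<integral>\<^sup>+ x. ennreal (d (g q x) (g w x) powr p) \<partial>Y) =
        ennreal ((1 - (q - r) / (w - r)) powr p * (((w - r) / (b - a)) powr p * K))"
      unfolding prod[OF nn(2,3)] 2 using int[OF I(2,3)] lt by (simp add: pow_integral_def)
    show "(\<integral>\<^sup>+ x. ennreal (d (g r x) (g w x) powr p) \<partial>Y) = ennreal (((w - r) / (b - a)) powr p * K)"
      using int[OF I(1,3)] lt by (simp add: pow_integral_def)
  qed (use K in simp_all)
  have from_a: "AE x in Y. d (g a x) (g r x) = (r - a) / (b - a) * d (g a x) (g b x)"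
    if r: "r \<in> {a..b}" for r
  proof -
    consider "r = a" | "r = b" | "a < r" "r < b" using r by fastforce
    then show ?thesis
    proof cases
      case 1
      show ?thesis using AE_space[of Y] by eventually_elim (use gM[OF abI(1)] 1 in simp)
    next
      case 2
      then show ?thesis using ab by simp
    next
      case 3
      show ?thesis using three[OF abI(1) r abI(2) 3] by eventually_elim simp
    qed
  qed
  have ordered: "AE x in Y. d (g r x) (g q x) = (q - r) / (b - a) * d (g a x) (g b x)"
    if I: "r \<in> {a..b}" "q \<in> {a..b}" and le: "r \<le> q" for r q
  proof -
    consider "r = a" | "r = q" | "a < r" "r < q" using I le by fastforce
    then show ?thesis
    proof cases
      case 1
      then show ?thesis using from_a[OF I(2)] by simp
    next
      case 2
      show ?thesis using AE_space[of Y] by eventually_elim (use gM[OF I(1)] 2 in simp)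
    next
      case 3
      have "1 - (r - a) / (q - a) = (q - r) / (q - a)" using 3 by (simp add: field_simps)
      then have eq: "(1 - (r - a) / (q - a)) * ((q - a) / (b - a) * z) = (q - r) / (b - a) * z" for z
        using 3 by simp
      show ?thesis
        using three[OF abI(1) I(1,2) 3] from_a[OF I(2)]
        by eventually_elim (simp only: eq)
    qed
  qed
  show ?thesis
  proof (cases "s \<le> t")
    case True
    then show ?thesis using ordered[OF s t] by (simp add: abs_minus_commute[of s t])
  next
    case False
    then show ?thesis using ordered[OF t s] by (simp add: commute[of "g s _"])
  qed
qed

text \<open>
On a set of full measure the constant speed identity holds simultaneously for all grid points.
There the values at the last grid points up to \<open>t\<close> form a Cauchy sequence, whose limit defines
\<open>\<gamma> x t\<close>; elsewhere \<open>\<gamma> x\<close> is a constant curve.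
\<close>

lemma (in Metric_space) geodesic_selection:
  assumes ab: "a < b" and ne: "M \<noteq> {}" and compl: "mcomplete"
    and g: "\<And>t. t \<in> {a..b} \<Longrightarrow> g t \<in> separably_measurable Y M d"
    and geo: "\<And>s t. s \<in> {a..b} \<Longrightarrow> t \<in> {a..b} \<Longrightarrow>
      AE x in Y. d (g s x) (g t x) = \<bar>s - t\<bar> / (b - a) * d (g a x) (g b x)"
  obtains \<gamma> where "\<And>x. x \<in> space Y \<Longrightarrow> \<gamma> x \<in> geodesics a b M d"
    "\<And>t. t \<in> {a..b} \<Longrightarrow> (\<lambda>x. \<gamma> x t) \<in> separably_measurable Y M d"
    "\<And>t. t \<in> {a..b} \<Longrightarrow> AE x in Y. \<gamma> x t = g t x"
proof -
  obtain z0 where z0: "z0 \<in> M" using ne by blast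
  define S where "S = (\<Union>n k. {grid a b n k})"
  have S: "countable S" "S \<subseteq> {a..b}"
    using ab grid_mem[of a b] unfolding S_def by (simp_all add: UN_subset_iff del: atLeastAtMost_iff)
  define L where "L x = d (g a x) (g b x)" for x
  define good where "good x \<longleftrightarrow> (\<forall>s\<in>S. \<forall>t\<in>S. d (g s x) (g t x) = \<bar>s - t\<bar> / (b - a) * L x)" for x
  have gM: "g t x \<in> M" if "t \<in> {a..b}" "x \<in> space Y" for t x
    using separably_measurable_space[OF g[OF that(1)] that(2)] .
  have dm[measurable]: "(\<lambda>x. d (g s x) (g t x)) \<in> borel_measurable Y" if "s \<in> {a..b}" "t \<in> {a..b}" for s t
    by (rule borel_measurable_mdist[OF g[OF that(1)] g[OF that(2)]])
  have [measurable]: "L \<in> borel_measurable Y" unfolding L_def using ab by (intro dm) auto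
  have "{x \<in> space Y. \<forall>s\<in>S. \<forall>t\<in>S. d (g s x) (g t x) = \<bar>s - t\<bar> / (b - a) * L x} \<in> sets Y"
  proof (intro sets.sets_Collect_countable_All' S(1))
    fix s t assume "s \<in> S" "t \<in> S"
    then have [measurable]: "(\<lambda>x. d (g s x) (g t x)) \<in> borel_measurable Y" using S(2) by (intro dm) auto
    show "{x \<in> space Y. d (g s x) (g t x) = \<bar>s - t\<bar> / (b - a) * L x} \<in> sets Y" by measurable
  qed
  then have good_meas: "good \<in> Y \<rightarrow>\<^sub>M count_space UNIV" unfolding good_def pred_def .
  have AE_good: "AE x in Y. good x"
    using geo S(2) unfolding good_def L_def AE_ball_countable[OF S(1)] by blast
  define q where "q n t = grid a b n (grid_index a b n t)" for n t
  have qS: "q n t \<in> S" for n t by (auto simp: q_def S_def)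
  then have qI: "q n t \<in> {a..b}" for n t using S(2) by blast
  have q: "(\<lambda>n. q n t) \<longlonglongrightarrow> t" "\<bar>q n t - t\<bar> \<le> (b - a) / Suc n" if "t \<in> {a..b}" for n t
    unfolding q_def by (rule grid_tendsto[OF ab that], rule grid_approx[OF ab that])
  define w where "w x t = (SOME y. y \<in> M \<and> (\<lambda>n. d (g (q n t) x) y) \<longlonglongrightarrow> 0)" for x t
  have w: "w x t \<in> M" "(\<lambda>n. d (g (q n t) x) (w x t)) \<longlonglongrightarrow> 0"
    if x: "x \<in> space Y" "good x" and t: "t \<in> {a..b}" for x t
  proof -
    have "MCauchy (\<lambda>n. g (q n t) x)"
      unfolding MCauchy_def
    proof (intro conjI allI impI)
      show "range (\<lambda>n. g (q n t) x) \<subseteq> M" using gM[OF qI x(1)] by blast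
      fix e :: real assume e: "e > 0"
      have L0: "0 \<le> L x" by (simp add: L_def)
      have "e / (2 * L x + 1) > 0" using e L0 by simp
      then obtain N :: nat where N: "1 / Suc N < e / (2 * L x + 1)" by (rule nat_approx_posE)
      have le: "d (g (q n t) x) (g (q n' t) x) < e" if n: "N \<le> n" "N \<le> n'" for n n'
      proof -
        have close: "\<bar>q m t - t\<bar> / (b - a) \<le> 1 / Suc N" if "N \<le> m" for m
        proof -
          have "\<bar>q m t - t\<bar> / (b - a) \<le> 1 / Suc m"
            using q(2)[OF t, of m] ab by (simp add: divide_le_eq)
          also have "\<dots> \<le> 1 / Suc N" using that by (simp add: frac_le)
          finally show ?thesis .
        qed
        have "\<bar>q n t - q n' t\<bar> / (b - a) \<le> (\<bar>q n t - t\<bar> + \<bar>q n' t - t\<bar>) / (b - a)"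
          using ab by (intro divide_right_mono) auto
        also have "\<dots> \<le> 2 * (1 / Suc N)"
          using close[OF n(1)] close[OF n(2)] by (simp add: add_divide_distrib)
        finally have "\<bar>q n t - q n' t\<bar> / (b - a) \<le> 2 * (1 / Suc N)" .
        then have "\<bar>q n t - q n' t\<bar> / (b - a) * L x \<le> 2 * (1 / Suc N) * L x"
          using L0 by (rule mult_right_mono)
        also have "\<dots> = 1 / Suc N * (2 * L x)" by simp
        also have "\<dots> \<le> 1 / Suc N * (2 * L x + 1)" by (intro mult_left_mono) auto
        also have "\<dots> < e" using N L0 by (simp add: pos_less_divide_eq del: of_nat_Suc)
        finally show ?thesis using x(2) qS unfolding good_def by simp
      qed
      show "\<exists>N. \<forall>n n'. N \<le> n \<longrightarrow> N \<le> n' \<longrightarrow> d (g (q n t) x) (g (q n' t) x) < e"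
        using le by (intro exI[of _ N]) simp
    qed
    then obtain y where "limitin mtopology (\<lambda>n. g (q n t) x) y sequentially"
      using compl unfolding mcomplete_def by blast
    then have "y \<in> M \<and> (\<lambda>n. d (g (q n t) x) y) \<longlonglongrightarrow> 0"
      by (simp add: limitin_metric_dist_null)
    then have "w x t \<in> M \<and> (\<lambda>n. d (g (q n t) x) (w x t)) \<longlonglongrightarrow> 0"
      unfolding w_def by (rule someI)
    then show "w x t \<in> M" "(\<lambda>n. d (g (q n t) x) (w x t)) \<longlonglongrightarrow> 0" by auto
  qed
  define \<gamma> where "\<gamma> x = (\<lambda>t\<in>{a..b}. if good x then w x t else z0)" for x
  have \<gamma>M: "\<gamma> x t \<in> M" if "x \<in> space Y" "t \<in> {a..b}" for x t
    using w(1)[of x t] that z0 by (simp add: \<gamma>_def)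
  have \<gamma>_lim: "(\<lambda>n. d (g (q n t) x) (\<gamma> x t)) \<longlonglongrightarrow> 0" if "x \<in> space Y" "good x" "t \<in> {a..b}" for x t
    using w(2)[OF that] that by (simp add: \<gamma>_def)
  have dist: "d (\<gamma> x s) (\<gamma> x t) = \<bar>s - t\<bar> / (b - a) * L x"
    if x: "x \<in> space Y" "good x" and st: "s \<in> {a..b}" "t \<in> {a..b}" for x s t
  proof (rule LIMSEQ_unique)
    show "(\<lambda>n. d (g (q n s) x) (g (q n t) x)) \<longlonglongrightarrow> d (\<gamma> x s) (\<gamma> x t)"
      by (rule tendsto_mdist) (use gM[OF qI] \<gamma>M \<gamma>_lim x st in simp_all)
    have "(\<lambda>n. \<bar>q n s - q n t\<bar> / (b - a) * L x) \<longlonglongrightarrow> \<bar>s - t\<bar> / (b - a) * L x"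
      using ab q(1)[OF st(1)] q(1)[OF st(2)] by (intro tendsto_intros) auto
    then show "(\<lambda>n. d (g (q n s) x) (g (q n t) x)) \<longlonglongrightarrow> \<bar>s - t\<bar> / (b - a) * L x"
      using x(2) qS unfolding good_def by simp
  qed
  show ?thesis
  proof (rule that[of \<gamma>])
    fix x assume x: "x \<in> space Y"
    have "d (\<gamma> x s) (\<gamma> x t) = \<bar>(t - s) / (b - a)\<bar> * d (\<gamma> x a) (\<gamma> x b)"
      if "s \<in> {a..b}" "t \<in> {a..b}" for s t
    proof (cases "good x")
      case True
      have "d (\<gamma> x a) (\<gamma> x b) = L x" using dist[OF x True, of a b] ab by simp
      then show ?thesis using dist[OF x True that] ab by (simp add: abs_minus_commute)
    next
      case False
      then show ?thesis using that ab z0 by (simp add: \<gamma>_def)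
    qed
    moreover have "\<gamma> x \<in> {a..b} \<rightarrow>\<^sub>E M" using \<gamma>M[OF x] unfolding \<gamma>_def by auto
    ultimately show "\<gamma> x \<in> geodesics a b M d" unfolding geodesics_def by blast
  next
    fix t assume t: "t \<in> {a..b}"
    show "(\<lambda>x. \<gamma> x t) \<in> separably_measurable Y M d"
    proof (rule separably_measurable_lim)
      show "(\<lambda>x. (\<lambda>i x. if i then g (q n t) x else z0) (good x) x) \<in> separably_measurable Y M d" for n
      proof (rule separably_measurable_countable_compose[OF _ good_meas])
        show "(\<lambda>x. if i then g (q n t) x else z0) \<in> separably_measurable Y M d" for i
          using g[OF qI, of n t] separably_measurable_const[OF z0] by (cases i) simp_all
      qed
      show "(\<lambda>x. \<gamma> x t) \<in> space Y \<rightarrow> M" using \<gamma>M t by blast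
      show "(\<lambda>n. d ((\<lambda>i x. if i then g (q n t) x else z0) (good x) x) (\<gamma> x t)) \<longlonglongrightarrow> 0"
        if "x \<in> space Y" for x
        using \<gamma>_lim[OF that _ t] z0 t by (cases "good x") (simp_all add: \<gamma>_def)
    qed
    \<comment> \<open>The time \<open>t\<close> need not be a grid point, but it may be adjoined to the countable set \<open>S\<close>.\<close>
    have "AE x in Y. \<forall>s\<in>S. d (g s x) (g t x) = \<bar>s - t\<bar> / (b - a) * L x"
      using geo[OF _ t] S(2) unfolding L_def AE_ball_countable[OF S(1)] by blast
    then show "AE x in Y. \<gamma> x t = g t x"
      using AE_good AE_space
    proof eventually_elim
      case (elim x)
      have "(\<lambda>n. \<bar>q n t - t\<bar> / (b - a) * L x) \<longlonglongrightarrow> \<bar>t - t\<bar> / (b - a) * L x"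
        using ab q(1)[OF t] by (intro tendsto_intros) auto
      then have "(\<lambda>n. d (g (q n t) x) (g t x)) \<longlonglongrightarrow> 0"
        using elim(1) qS by simp
      then have "(\<lambda>n. d (g (q n t) x) (g (q n t) x)) \<longlonglongrightarrow> d (\<gamma> x t) (g t x)"
        using \<gamma>_lim[OF elim(3,2) t] gM[OF qI elim(3)] gM[OF t elim(3)] \<gamma>M[OF elim(3) t]
        by (intro tendsto_mdist)
      then have "d (\<gamma> x t) (g t x) = 0"
        using gM[OF qI elim(3)] by (simp add: LIMSEQ_const_iff)
      then show ?case using gM[OF t elim(3)] \<gamma>M[OF elim(3) t] by simp
    qed
  qed
qed

text \<open>
Both assertions rest on the bound \<open>d (\<gamma> x t) (h x) \<le> W x\<close>, uniform in \<open>t\<close>, by a function whose \<open>p\<close>-th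
power is integrable over \<open>Y\<close>.  It shows that the joint map \<open>\<Gamma>\<close> lies in the domain of the inverse of
\<open>sec_I\<close>, and that \<open>\<gamma>\<close> has finite distance to the constant curves.
\<close>

lemma (in Metric_space) i_tilde_geodesic:
  fixes Y :: "'m measure" and a b p :: real and h :: "'m \<Rightarrow> 'a"
  assumes ab: "a < b" and p: "1 < p"
    and h: "h \<in> separably_measurable Y M d"
    and geo: "\<And>x. x \<in> space Y \<Longrightarrow> \<gamma> x \<in> geodesics a b M d"
    and meas: "\<And>t. t \<in> {a..b} \<Longrightarrow> (\<lambda>x. \<gamma> x t) \<in> separably_measurable Y M d"
    and c: "\<And>t. t \<in> {a..b} \<Longrightarrow> c t = ae_class Y (\<lambda>x. \<gamma> x t)"
    and fin: "pow_integral p Y d (\<lambda>x. \<gamma> x a) h < \<infinity>"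
      "pow_integral p Y d (\<lambda>x. \<gamma> x a) (\<lambda>x. \<gamma> x b) < \<infinity>"
  shows "i_tilde p a b Y M d (ae_class Y h) c = ae_class Y \<gamma>"
    and "ae_class Y \<gamma> \<in>
      Lp p Y (geodesics a b M d) (fun_dist p (leb a b) d) (const_curves a b Y (ae_class Y h))"
proof -
  let ?I = "leb a b"
  let ?P = "prod_caratheodory ?I Y"
  have abI: "a \<in> {a..b}" "b \<in> {a..b}" using ab by auto
  have \<gamma>M: "\<gamma> x t \<in> M" if "x \<in> space Y" "t \<in> {a..b}" for x t
    by (rule geodesics_mem[OF geo[OF that(1)] that(2)])
  have hM: "h x \<in> M" if "x \<in> space Y" for x by (rule separably_measurable_space[OF h that])
  define W where "W x = d (\<gamma> x a) (h x) + d (\<gamma> x a) (\<gamma> x b)" for x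
  have [measurable]: "(\<lambda>x. d (\<gamma> x a) (h x)) \<in> borel_measurable Y"
    "(\<lambda>x. d (\<gamma> x a) (\<gamma> x b)) \<in> borel_measurable Y"
    by (rule borel_measurable_mdist; fact meas[OF abI(1)] meas[OF abI(2)] h)+
  have W_meas[measurable]: "W \<in> borel_measurable Y" unfolding W_def by measurable
  have W_fin: "(\<integral>\<^sup>+ x. ennreal (W x powr p) \<partial>Y) < \<infinity>"
    by (rule nn_integral_powr_add_finite[where u="\<lambda>x. d (\<gamma> x a) (h x)"
          and v="\<lambda>x. d (\<gamma> x a) (\<gamma> x b)"])
       (use p fin in \<open>simp_all add: W_def pow_integral_def\<close>)
  have W_bound: "d (\<gamma> x t) (h x) \<le> W x" if x: "x \<in> space Y" and t: "t \<in> {a..b}" for x t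
  proof -
    have "d (\<gamma> x a) (\<gamma> x t) = (t - a) / (b - a) * d (\<gamma> x a) (\<gamma> x b)"
      using geodesics_dist[OF geo[OF x] abI(1) t] ab t by simp
    also have "\<dots> \<le> 1 * d (\<gamma> x a) (\<gamma> x b)" using ab t by (intro mult_right_mono) auto
    finally have "d (\<gamma> x a) (\<gamma> x t) \<le> d (\<gamma> x a) (\<gamma> x b)" by simp
    then show ?thesis
      using triangle''[OF \<gamma>M[OF x t] \<gamma>M[OF x abI(1)] hM[OF x]] by (simp add: W_def)
  qed

  define \<Gamma> where "\<Gamma> z = \<gamma> (snd z) (fst z)" for z
  have snd: "snd \<in> ?P \<rightarrow>\<^sub>M Y" by (rule measurable_snd_prod_caratheodory)
  have spP: "fst z \<in> {a..b}" "snd z \<in> space Y" if "z \<in> space ?P" for z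
    using that by (auto simp: space_prod_caratheodory)
  have id: "(\<lambda>t. t) \<in> borel_measurable ?I"
    by (intro measurable_restrict_space1 measurable_completion) simp
  have \<Gamma>: "\<Gamma> \<in> separably_measurable ?P M d"
    unfolding \<Gamma>_def
  proof (rule separably_measurable_curve_compose[OF ab, where \<kappa>="\<lambda>z. \<gamma> (snd z)"
        and L="\<lambda>z. d (\<gamma> (snd z) a) (\<gamma> (snd z) b) / (b - a)"])
    show "(\<lambda>z. \<gamma> (snd z) t) \<in> separably_measurable ?P M d" if "t \<in> {a..b}" for t
      by (rule separably_measurable_compose[OF meas[OF that] snd])
    show "d (\<gamma> (snd z) s) (\<gamma> (snd z) t) \<le>
        d (\<gamma> (snd z) a) (\<gamma> (snd z) b) / (b - a) * \<bar>s - t\<bar>"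
      if "z \<in> space ?P" "s \<in> {a..b}" "t \<in> {a..b}" for z s t
      using geodesics_constant_speed[OF ab geo[OF spP(2)[OF that(1)]] that(2,3)] by simp
    show "fst \<in> borel_measurable ?P"
      by (rule measurable_compose[OF measurable_fst_prod_caratheodory id])
  qed (rule spP)
  have hs: "(\<lambda>z. h (snd z)) \<in> separably_measurable ?P M d"
    by (rule separably_measurable_compose[OF h snd])
  have hat_eq: "hat a b Y (ae_class Y h) = ae_class ?P (\<lambda>z. h (snd z))"
    unfolding hat_def ae_class_eq_iff
    using AE_prod_caratheodory_snd[OF AE_rep_ae_class[of Y h], of ?I]
    by eventually_elim (simp add: case_prod_beta)
  have \<Gamma>_fin: "pow_integral p ?P d \<Gamma> (\<lambda>z. h (snd z)) < \<infinity>"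
  proof -
    have "pow_integral p ?P d \<Gamma> (\<lambda>z. h (snd z)) \<le> (\<integral>\<^sup>+ z. ennreal (W (snd z) powr p) \<partial>?P)"
      unfolding pow_integral_def \<Gamma>_def
      using W_bound[OF spP(2,1)] p by (intro nn_integral_mono ennreal_leI powr_mono2) auto
    also have "\<dots> \<le> emeasure ?I (space ?I) * (\<integral>\<^sup>+ x. ennreal (W x powr p) \<partial>Y)"
      by (rule nn_integral_prod_caratheodory_snd_le[where g="\<lambda>x. ennreal (W x powr p)"]) measurable
    also have "\<dots> < \<infinity>"
      using W_fin by (simp add: ennreal_mult_less_top emeasure_restrict_space emeasure_lborel_Icc_eq)
    finally show ?thesis .
  qed
  let ?C = "ae_class ?P \<Gamma>"
  let ?Lp = "Lp p ?P M d (hat a b Y (ae_class Y h))"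
  have C: "?C \<in> ?Lp"
    using ae_class_in_L0[OF \<Gamma>] \<Gamma>_fin by (simp add: Lp_def hat_eq pow_integral_rep)
  note sec\<Gamma> = AE_prod_caratheodory_sections[OF AE_rep_ae_class[of ?P \<Gamma>]]
  have sec_IC: "sec_I a b Y ?C = ae_class ?I c"
    unfolding sec_I_def ae_class_eq_iff
    using sec\<Gamma>(1) AE_space[of ?I]
  proof eventually_elim
    case (elim t)
    have "ae_class Y (\<lambda>x. rep ?C (t, x)) = ae_class Y (\<lambda>x. \<gamma> x t)"
      using elim(1) unfolding ae_class_eq_iff by (simp add: \<Gamma>_def)
    then show ?case using c[of t] elim(2) by simp
  qed
  \<comment> \<open>Membership in \<open>L\<^sup>p\<close> gives \<open>C'\<close> and \<open>\<Gamma>\<close> finite distance, so their sections determine them.\<close>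
  have unique: "C' = ?C" if C': "C' \<in> ?Lp" "sec_I a b Y C' = ae_class ?I c" for C'
  proof -
    obtain f where f: "f \<in> separably_measurable ?P M d" "C' = ae_class ?P f"
      using C'(1) by (auto simp: Lp_def L0_def)
    have "pow_integral p ?P d f (\<lambda>z. h (snd z)) < \<infinity>"
      using C'(1) by (simp add: Lp_def f(2) hat_eq pow_integral_rep)
    then have "pow_integral p ?P d f \<Gamma> < \<infinity>"
      using p \<Gamma>_fin by (intro pow_integral_finite_triangle[OF _ f(1) \<Gamma> hs]) auto
    moreover have "AE t in ?I. AE x in Y. f (t, x) = \<Gamma> (t, x)"
      using AE_prod_caratheodory_sections(1)[OF AE_rep_ae_class[of ?P f]] AE_space[of ?I]
        C'(2)[unfolded sec_I_def ae_class_eq_iff f(2)]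
    proof eventually_elim
      case (elim t)
      have "ae_class Y (\<lambda>x. rep (ae_class ?P f) (t, x)) = ae_class Y (\<lambda>x. \<gamma> x t)"
        using elim(3) c[of t] elim(2) by simp
      then have "AE x in Y. rep (ae_class ?P f) (t, x) = \<gamma> x t"
        unfolding ae_class_eq_iff .
      then show ?case using elim(1) by eventually_elim (simp add: \<Gamma>_def)
    qed
    ultimately have "AE z in ?P. f z = \<Gamma> z"
      by (rule AE_prod_caratheodory_eqI[OF f(1) \<Gamma>])
    then show ?thesis unfolding f(2) ae_class_eq_iff .
  qed
  have "inv_into ?Lp (sec_I a b Y) (ae_class ?I c) = ?C"
  proof (rule unique)
    have img: "ae_class ?I c \<in> sec_I a b Y ` ?Lp" using C sec_IC by (metis imageI)
    show "inv_into ?Lp (sec_I a b Y) (ae_class ?I c) \<in> ?Lp" by (rule inv_into_into[OF img])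
    show "sec_I a b Y (inv_into ?Lp (sec_I a b Y) (ae_class ?I c)) = ae_class ?I c"
      by (rule f_inv_into_f[OF img])
  qed
  then have i_bar: "i_bar p a b Y M d (ae_class Y h) (ae_class ?I c) = sec_M a b Y ?C"
    by (simp add: i_bar_def)
  have "AE x in Y. ae_class ?I (\<lambda>t. rep ?C (t, x)) = ae_class ?I (\<gamma> x)"
    using sec\<Gamma>(2) unfolding ae_class_eq_iff by (simp add: \<Gamma>_def)
  then have rep_sec: "AE x in Y. rep (sec_M a b Y ?C) x = ae_class ?I (\<gamma> x)"
    using AE_rep_ae_class[of Y "\<lambda>x. ae_class ?I (\<lambda>t. rep ?C (t, x))"]
    unfolding sec_M_def by eventually_elim simp
  have "AE x in Y. inv_into (AC p a b M d) (ae_class ?I) (rep (sec_M a b Y ?C) x) = \<gamma> x"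
    using rep_sec AE_space[of Y]
  proof eventually_elim
    case (elim x)
    have "\<gamma> x \<in> AC p a b M d" using geodesics_subset_AC[OF ab] geo[OF elim(2)] by blast
    then show ?case
      using inj_on_ae_class_AC[of p a b] p ab unfolding elim(1) by (intro inv_into_f_f) auto
  qed
  then show "i_tilde p a b Y M d (ae_class Y h) c = ae_class Y \<gamma>"
    by (simp add: i_tilde_def i_bar postcomp_q_inv_def ae_class_eq_iff)

  let ?G = "geodesics a b M d" and ?D = "fun_dist p ?I d"
  have \<gamma>: "\<gamma> \<in> separably_measurable Y ?G ?D"
    by (rule separably_measurable_geodesics[OF p ab geo meas])
  have const_eq: "const_curves a b Y (ae_class Y h) = ae_class Y (\<lambda>x. \<lambda>t\<in>{a..b}. h x)"
    unfolding const_curves_def ae_class_eq_iff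
    using AE_rep_ae_class[of Y h] by eventually_elim simp
  have "pow_integral p Y ?D \<gamma> (\<lambda>x. \<lambda>t\<in>{a..b}. h x) \<le>
      (\<integral>\<^sup>+ x. ennreal (b - a) * ennreal (W x powr p) \<partial>Y)"
    unfolding pow_integral_def[of p Y]
  proof (rule nn_integral_mono)
    fix x assume x: "x \<in> space Y"
    have "?D (\<gamma> x) (\<lambda>t\<in>{a..b}. h x) \<le> W x * (b - a) powr (1 / p)"
      using W_bound[OF x] p ab by (intro fun_dist_curves_le) auto
    then have "?D (\<gamma> x) (\<lambda>t\<in>{a..b}. h x) powr p \<le> (W x * (b - a) powr (1 / p)) powr p"
      using p by (intro powr_mono2) (auto simp: fun_dist_def)
    also have "\<dots> = (b - a) * W x powr p"
      using p ab by (simp add: powr_mult powr_powr)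
    finally show "ennreal (?D (\<gamma> x) (\<lambda>t\<in>{a..b}. h x) powr p) \<le> ennreal (b - a) * ennreal (W x powr p)"
      using ab by (simp add: ennreal_mult[symmetric] ennreal_leI)
  qed
  also have "\<dots> = ennreal (b - a) * (\<integral>\<^sup>+ x. ennreal (W x powr p) \<partial>Y)"
    by (rule nn_integral_cmult) measurable
  also have "\<dots> < \<infinity>" using W_fin by (simp add: ennreal_mult_less_top)
  finally have "pow_integral p Y ?D \<gamma> (\<lambda>x. \<lambda>t\<in>{a..b}. h x) < \<infinity>" .
  then show "ae_class Y \<gamma> \<in> Lp p Y ?G ?D (const_curves a b Y (ae_class Y h))"
    using ae_class_in_L0[OF \<gamma>] by (simp add: Lp_def const_eq pow_integral_rep)
qed

theorem theorem4p2:
  fixes M :: "'m measure" and N :: "'n set" and d :: "'n \<Rightarrow> 'n \<Rightarrow> real"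
    and a b p :: real and h :: "('m \<Rightarrow> 'n) set"
  assumes "space M \<noteq> {}"
    and "Metric_space N d" and "N \<noteq> {}"
    and "a < b"
    and "h \<in> L0 M N d"
    and "1 < p"
    and "Metric_space.mcomplete N d"
  shows "i_tilde p a b M N d h ` geodesics a b (Lp p M N d h) (Lp_dist p M d)
           \<subseteq> Lp p M (geodesics a b N d) (fun_dist p (leb a b) d) (const_curves a b M h)"
proof (rule image_subsetI)
  interpret N: Metric_space N d by fact
  fix c assume c: "c \<in> geodesics a b (Lp p M N d h) (Lp_dist p M d)"
  obtain k where k: "k \<in> separably_measurable M N d" "h = ae_class M k"
    using \<open>h \<in> L0 M N d\<close> by (auto simp: L0_def)
  have abI: "a \<in> {a..b}" "b \<in> {a..b}" using \<open>a < b\<close> by auto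
  have cL: "c t \<in> Lp p M N d h" if "t \<in> {a..b}" for t
    by (rule geodesics_mem[OF c that])
  then have "\<exists>f. f \<in> separably_measurable M N d \<and> c t = ae_class M f" if "t \<in> {a..b}" for t
    using that by (force simp: Lp_def L0_def)
  then obtain g where g: "\<And>t. t \<in> {a..b} \<Longrightarrow> g t \<in> separably_measurable M N d"
    and cg: "\<And>t. t \<in> {a..b} \<Longrightarrow> c t = ae_class M (g t)"
    by metis
  obtain \<gamma> where \<gamma>: "\<And>x. x \<in> space M \<Longrightarrow> \<gamma> x \<in> geodesics a b N d"
    "\<And>t. t \<in> {a..b} \<Longrightarrow> (\<lambda>x. \<gamma> x t) \<in> separably_measurable M N d"
    "\<And>t. t \<in> {a..b} \<Longrightarrow> AE x in M. \<gamma> x t = g t x"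
    using N.geodesic_selection[OF \<open>a < b\<close> \<open>N \<noteq> {}\<close> \<open>N.mcomplete\<close> g
        N.Lp_geodesic_pointwise[OF \<open>1 < p\<close> \<open>a < b\<close> c \<open>h \<in> L0 M N d\<close> g cg]]
    by metis
  have c\<gamma>: "c t = ae_class M (\<lambda>x. \<gamma> x t)" if "t \<in> {a..b}" for t
    using \<gamma>(3)[OF that] unfolding cg[OF that] ae_class_eq_iff by eventually_elim simp
  have fin: "pow_integral p M d (\<lambda>x. \<gamma> x t) k < \<infinity>" if "t \<in> {a..b}" for t
    using cL[OF that] by (simp add: Lp_def c\<gamma>[OF that] k(2) pow_integral_rep)
  have fin': "pow_integral p M d (\<lambda>x. \<gamma> x a) (\<lambda>x. \<gamma> x b) < \<infinity>"
    by (rule N.pow_integral_finite_triangle[OF _ \<gamma>(2)[OF abI(1)] \<gamma>(2)[OF abI(2)] k(1)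
          fin[OF abI(1)] fin[OF abI(2)]]) (use \<open>1 < p\<close> in simp)
  show "i_tilde p a b M N d h c \<in>
      Lp p M (geodesics a b N d) (fun_dist p (leb a b) d) (const_curves a b M h)"
    using N.i_tilde_geodesic[OF \<open>a < b\<close> \<open>1 < p\<close> k(1) \<gamma>(1,2) c\<gamma> fin[OF abI(1)] fin']
    unfolding k(2) by simp
qed

end
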